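(* Let $\rho,\sigma$ be gauges, let $U\subseteq{}^{\rho}\widetilde{\mathbb R}$ be a sharply open set, and let $(x_n)_n,(y_n)_n:{}^{\sigma}\widetilde{\mathbb N}\to U$ be hypersequences converging to $l\in U$ and $m\in U$ respectively, and such that $$\operatorname{hyperlim}_n\frac{x_n-l}{y_n-m}=:C\in{}^{\rho}\widetilde{\mathbb R}$$ exists. Let $k\in\mathbb N_{>0}$ and let $f,g:U\to{}^{\rho}\widetilde{\mathbb R}$ be generalized smooth functions such that for all $n\in{}^{\sigma}\widetilde{\mathbb N}$ and all $j=0,\dots,k-1$: $g^{(j)}(y_n)$ is invertible, $f^{(j)}(l)=g^{(j)}(m)=0$, and $g^{(k)}(m)$ is invertible. Then for all $j=0,\dots,k-1$ the hyperlimit of $\left(\frac{f^{(j)}(x_n)}{g^{(j)}(y_n)}\right)_n$ exists and $$\operatorname{hyperlim}_n\frac{f^{(j)}(x_n)}{g^{(j)}(y_n)}=C^{k}\cdot\operatorname{hyperlim}_n\frac{f^{(k)}(x_n)}{g^{(k)}(y_n)}.$$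
   Context: Let $I=(0,1]$. A gauge is a net $\rho=(\rho_\varepsilon)_{\varepsilon\in I}\in(0,1]^I$ with $\rho_\varepsilon\to0$ as $\varepsilon\to0^+$. "$\forall^0\varepsilon:\ P(\varepsilon)$" means: there is $\varepsilon_0\in I$ such that $P(\varepsilon)$ holds for all $\varepsilon\in(0,\varepsilon_0]$. $\mathbb R_\rho$ is the ring of $\rho$-moderate nets: $(x_\varepsilon)\in\mathbb R^I$ with $\exists N\in\mathbb N\,\forall^0\varepsilon:\ |x_\varepsilon|\le\rho_\varepsilon^{-N}$. Write $(x_\varepsilon)\sim_\rho(y_\varepsilon)$ if $\forall n\in\mathbb N\,\forall^0\varepsilon:\ |x_\varepsilon-y_\varepsilon|\le\rho_\varepsilon^n$; a net is $\rho$-negligible if it is $\sim_\rho 0$. ${}^{\rho}\widetilde{\mathbb R}:=\mathbb R_\rho/\sim_\rho$ (a ring with pointwise operations); classes are denoted $[x_\varepsilon]$. A quotient $a/b$ in this ring means $a\cdot b^{-1}$ and presupposes that $b$ is invertible. Order: $[x_\varepsilon]\le[y_\varepsilon]$ iff there is a $\rho$-negligible $(z_\varepsilon)$ with $\forall^0\varepsilon:\ x_\varepsilon\le y_\varepsilon+z_\varepsilon$; $x<y$ means $x\le y$ and $y-x$ is invertible. $|[x_\varepsilon]|:=[|x_\varepsilon|]$, and $\mathrm d\rho:=[\rho_\varepsilon]$. The sharp topology on ${}^{\rho}\widetilde{\mathbb R}$ has as base the balls $B_r(x)=\{y\mid |y-x|<r\}$, $r>0$; sharply open means open in this topology. Given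 a gauge $\sigma$, ${}^{\sigma}\widetilde{\mathbb N}:=\{[n_\varepsilon]\in{}^{\sigma}\widetilde{\mathbb R}\mid n_\varepsilon\in\mathbb N\ \forall\varepsilon\}$, ordered by the order of ${}^{\sigma}\widetilde{\mathbb R}$. A hypersequence is a map $x:{}^{\sigma}\widetilde{\mathbb N}\to{}^{\rho}\widetilde{\mathbb R}$, $x_n:=x(n)$. An element $l\in{}^{\rho}\widetilde{\mathbb R}$ is the hyperlimit of $(x_n)_n$, written $\operatorname{hyperlim}_n x_n=l$ (and $(x_n)_n$ is said to converge to $l$), if $\forall q\in\mathbb N\,\exists M\in{}^{\sigma}\widetilde{\mathbb N}\,\forall n\in{}^{\sigma}\widetilde{\mathbb N},\ n\ge M:\ |x_n-l|<\mathrm d\rho^q$; the same definition is used for expressions defined only for all $n\ge N$, for some $N\in{}^{\sigma}\widetilde{\mathbb N}$. Generalized smooth function: for $U\subseteq{}^{\rho}\widetilde{\mathbb R}$, a map $f:U\to{}^{\rho}\widetilde{\mathbb R}$ is a generalized smooth function if there is a net $(f_\varepsilon)_{\varepsilon\in I}$ of functions $f_\varepsilon\in\mathcal C^\infty(\mathbb R,\mathbb R)$ such that for all $x=[x_\varepsilon]\in U$: $f(x)=[f_\varepsilon(x_\varepsilon)]$ and, for all $j\in\mathbb N$, the net $(f_\varepsilon^{(j)}(x_\varepsilon))$ is $\rho$-moderate. For $U$ sharply open, the derivatives are $f^{(j)}(x):=[f_\varepsilon^{(j)}(x_\varepsilon)]$; these are well defined (independent of the representatives and of the defining net) and are again generalized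 smooth functions on $U$.
   Formalization: The factor C^k is replaced by C^{k-j}: as printed the formula fails for j≥1, e.g. σ=ρ, f(t)=g(t)=t², x_n=2/(n+1), y_n=1/(n+1), l=m=0, k=2, j=1 gives 2 on the left and 4 on the right; for j=0 the two formulas coincide. *)

theory Defs
  imports "HOL-Analysis.Analysis" "HOL-Algebra.QuotRing"
begin

text \<open>
  Nets indexed by \<open>(0,1]\<close> are total functions on \<open>real\<close> whose values outside \<open>(0,1]\<close> are
  ignored: every notion below depends only on the values for all sufficiently small positive
  \<open>\<epsilon>\<close>, or is explicitly restricted to \<open>{0<..1}\<close>. The quantifier ``for all \<open>\<epsilon>\<close> small'' is
  \<open>eventually\<close> along the filter \<open>at_right 0\<close>.
\<close>

type_synonym net = "real \<Rightarrow> real"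

lemma eventually_small_iff:
  "(\<forall>\<^sub>F \<epsilon> in at_right (0::real). P \<epsilon>) \<longleftrightarrow> (\<exists>\<epsilon>0\<in>{0<..1}. \<forall>\<epsilon>\<in>{0<..\<epsilon>0}. P \<epsilon>)"
proof
  assume "\<forall>\<^sub>F \<epsilon> in at_right (0::real). P \<epsilon>"
  then obtain b where "b > 0" "\<And>\<epsilon>. 0 < \<epsilon> \<Longrightarrow> \<epsilon> < b \<Longrightarrow> P \<epsilon>"
    by (auto simp: eventually_at_right[of 0 1])
  then show "\<exists>\<epsilon>0\<in>{0<..1}. \<forall>\<epsilon>\<in>{0<..\<epsilon>0}. P \<epsilon>"
    by (intro bexI[of _ "min 1 (b/2)"]) auto
qed (auto simp: eventually_at_right[of 0 1])

definition net_gauge :: "net \<Rightarrow> bool" where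
  "net_gauge \<rho> \<longleftrightarrow> (\<forall>\<epsilon>\<in>{0<..1}. 0 < \<rho> \<epsilon> \<and> \<rho> \<epsilon> \<le> 1) \<and> (\<rho> \<longlongrightarrow> 0) (at_right 0)"

definition moderate :: "net \<Rightarrow> net \<Rightarrow> bool" where
  "moderate \<rho> x \<longleftrightarrow> (\<exists>N::nat. \<forall>\<^sub>F \<epsilon> in at_right 0. \<bar>x \<epsilon>\<bar> \<le> inverse (\<rho> \<epsilon> ^ N))"

definition net_equiv :: "net \<Rightarrow> net \<Rightarrow> net \<Rightarrow> bool" where
  "net_equiv \<rho> x y \<longleftrightarrow> (\<forall>n::nat. \<forall>\<^sub>F \<epsilon> in at_right 0. \<bar>x \<epsilon> - y \<epsilon>\<bar> \<le> \<rho> \<epsilon> ^ n)"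

definition negligible_net :: "net \<Rightarrow> net \<Rightarrow> bool" where
  "negligible_net \<rho> x \<longleftrightarrow> net_equiv \<rho> x (\<lambda>_. 0)"

definition moderate_ring :: "net \<Rightarrow> net ring" where
  "moderate_ring \<rho> =
    \<lparr>carrier = {x. moderate \<rho> x},
     mult = (\<lambda>x y \<epsilon>. x \<epsilon> * y \<epsilon>), one = (\<lambda>_. 1),
     zero = (\<lambda>_. 0), add = (\<lambda>x y \<epsilon>. x \<epsilon> + y \<epsilon>)\<rparr>"

text \<open>
  The relation \<open>net_equiv \<rho>\<close> is congruence modulo the ideal of negligible nets, so the ring of
  generalized numbers is a quotient ring of \<open>moderate_ring \<rho>\<close>; lemma \<open>gclass_eq_equiv_class\<close>
  below identifies its cosets with the equivalence classes of \<open>net_equiv \<rho>\<close>.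
\<close>

definition gring :: "net \<Rightarrow> net set ring" where
  "gring \<rho> = moderate_ring \<rho> Quot {z. negligible_net \<rho> z}"

definition gclass :: "net \<Rightarrow> net \<Rightarrow> net set" where
  "gclass \<rho> x = {z. negligible_net \<rho> z} +>\<^bsub>moderate_ring \<rho>\<^esub> x"

definition gle :: "net \<Rightarrow> net set \<Rightarrow> net set \<Rightarrow> bool" where
  "gle \<rho> X Y \<longleftrightarrow>
    (\<exists>x\<in>X. \<exists>y\<in>Y. \<exists>z. negligible_net \<rho> z \<and> (\<forall>\<^sub>F \<epsilon> in at_right 0. x \<epsilon> \<le> y \<epsilon> + z \<epsilon>))"

definition glt :: "net \<Rightarrow> net set \<Rightarrow> net set \<Rightarrow> bool" where
  "glt \<rho> X Y \<longleftrightarrow> gle \<rho> X Y \<and> Y \<ominus>\<^bsub>gring \<rho>\<^esub> X \<in> Units (gring \<rho>)"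

text \<open>The union over all representatives is a single class, see lemma \<open>gabs_gclass\<close>.\<close>

definition gabs :: "net \<Rightarrow> net set \<Rightarrow> net set" where
  "gabs \<rho> X = (\<Union>x\<in>X. gclass \<rho> (\<lambda>\<epsilon>. \<bar>x \<epsilon>\<bar>))"

text \<open>
  A quotient is undefined unless the denominator is invertible. The empty set, which is not
  an element of \<open>carrier (gring \<rho>)\<close>, serves as the undefined value.
\<close>

definition gdiv :: "net \<Rightarrow> net set \<Rightarrow> net set \<Rightarrow> net set" where
  "gdiv \<rho> X Y = (if Y \<in> Units (gring \<rho>) then X \<otimes>\<^bsub>gring \<rho>\<^esub> inv\<^bsub>gring \<rho>\<^esub> Y else {})"

definition sharp_ball :: "net \<Rightarrow> net set \<Rightarrow> net set \<Rightarrow> net set set" where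
  "sharp_ball \<rho> x r = {y \<in> carrier (gring \<rho>). glt \<rho> (gabs \<rho> (y \<ominus>\<^bsub>gring \<rho>\<^esub> x)) r}"

definition sharp_topology :: "net \<Rightarrow> net set topology" where
  "sharp_topology \<rho> = topology_generated_by
    {sharp_ball \<rho> x r | x r. x \<in> carrier (gring \<rho>) \<and> r \<in> carrier (gring \<rho>) \<and> glt \<rho> \<zero>\<^bsub>gring \<rho>\<^esub> r}"

definition hypernat :: "net \<Rightarrow> net set set" where
  "hypernat \<sigma> = {gclass \<sigma> (\<lambda>\<epsilon>. real (n \<epsilon>)) | n :: real \<Rightarrow> nat. moderate \<sigma> (\<lambda>\<epsilon>. real (n \<epsilon>))}"

text \<open>
  The condition \<open>x n \<in> carrier (gring \<rho>)\<close> expresses that the term \<open>x n\<close> is defined; thus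
  \<open>has_hyperlim\<close> also applies to expressions that are defined only for all \<open>n \<ge> N\<close>, and it
  then includes the assertion that such an \<open>N\<close> exists.
\<close>

definition has_hyperlim :: "net \<Rightarrow> net \<Rightarrow> (net set \<Rightarrow> net set) \<Rightarrow> net set \<Rightarrow> bool" where
  "has_hyperlim \<sigma> \<rho> x l \<longleftrightarrow>
    l \<in> carrier (gring \<rho>) \<and>
    (\<forall>q::nat. \<exists>M\<in>hypernat \<sigma>. \<forall>n\<in>hypernat \<sigma>. gle \<sigma> M n \<longrightarrow>
       x n \<in> carrier (gring \<rho>) \<and>
       glt \<rho> (gabs \<rho> (x n \<ominus>\<^bsub>gring \<rho>\<^esub> l)) (gclass \<rho> \<rho> [^]\<^bsub>gring \<rho>\<^esub> q))"

definition smooth_fun :: "(real \<Rightarrow> real) \<Rightarrow> bool" where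
  "smooth_fun h \<longleftrightarrow> (\<forall>j x. (deriv ^^ j) h differentiable at x)"

definition defining_net ::
    "net \<Rightarrow> net set set \<Rightarrow> (net set \<Rightarrow> net set) \<Rightarrow> (real \<Rightarrow> real \<Rightarrow> real) \<Rightarrow> bool" where
  "defining_net \<rho> U f F \<longleftrightarrow>
    (\<forall>\<epsilon>\<in>{0<..1}. smooth_fun (F \<epsilon>)) \<and>
    (\<forall>x. moderate \<rho> x \<and> gclass \<rho> x \<in> U \<longrightarrow>
       f (gclass \<rho> x) = gclass \<rho> (\<lambda>\<epsilon>. F \<epsilon> (x \<epsilon>)) \<and>
       (\<forall>j. moderate \<rho> (\<lambda>\<epsilon>. (deriv ^^ j) (F \<epsilon>) (x \<epsilon>))))"

definition gen_smooth :: "net \<Rightarrow> net set set \<Rightarrow> (net set \<Rightarrow> net set) \<Rightarrow> bool" where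
  "gen_smooth \<rho> U f \<longleftrightarrow> U \<subseteq> carrier (gring \<rho>) \<and> (\<exists>F. defining_net \<rho> U f F)"

text \<open>
  For sharply open \<open>U\<close> and \<open>X \<in> U\<close> the class of the net of derivatives depends neither on the
  defining net nor on the representative, so an arbitrary defining net may be chosen, and
  the union over all representatives of \<open>X\<close> is a single class.
\<close>

definition gs_deriv :: "net \<Rightarrow> net set set \<Rightarrow> (net set \<Rightarrow> net set) \<Rightarrow> nat \<Rightarrow> net set \<Rightarrow> net set" where
  "gs_deriv \<rho> U f j X =
    (let F = (SOME F. defining_net \<rho> U f F)
     in \<Union>x\<in>X. gclass \<rho> (\<lambda>\<epsilon>. (deriv ^^ j) (F \<epsilon>) (x \<epsilon>)))"


lemma net_gaugeD:
  assumes "net_gauge \<rho>"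
  shows "\<forall>\<^sub>F \<epsilon> in at_right 0. 0 < \<rho> \<epsilon> \<and> \<rho> \<epsilon> \<le> 1"
  using assms unfolding net_gauge_def eventually_small_iff by (intro bexI[of _ 1]) auto

lemma net_gauge_small:
  assumes "net_gauge \<rho>" "c > 0"
  shows "\<forall>\<^sub>F \<epsilon> in at_right 0. \<rho> \<epsilon> \<le> c"
  using assms order_tendstoD(2)[of \<rho> 0 "at_right 0" c] unfolding net_gauge_def
  by (auto elim: eventually_mono)

lemma moderate_add:
  assumes g: "net_gauge \<rho>" and "moderate \<rho> x" "moderate \<rho> y"
  shows "moderate \<rho> (\<lambda>\<epsilon>. x \<epsilon> + y \<epsilon>)"
proof -
  obtain N M where N: "\<forall>\<^sub>F \<epsilon> in at_right 0. \<bar>x \<epsilon>\<bar> \<le> inverse (\<rho> \<epsilon> ^ N)"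
    and M: "\<forall>\<^sub>F \<epsilon> in at_right 0. \<bar>y \<epsilon>\<bar> \<le> inverse (\<rho> \<epsilon> ^ M)"
    using assms unfolding moderate_def by auto
  have "\<forall>\<^sub>F \<epsilon> in at_right 0. \<bar>x \<epsilon> + y \<epsilon>\<bar> \<le> inverse (\<rho> \<epsilon> ^ (N + M + 1))"
    using N M net_gaugeD[OF g] net_gauge_small[OF g, of "1/2", simplified]
  proof eventually_elim
    case (elim \<epsilon>)
    let ?r = "inverse (\<rho> \<epsilon>)"
    have r: "1 \<le> ?r" "2 \<le> ?r" using elim by (auto simp: field_simps)
    have "?r ^ N \<le> ?r ^ (N + M)" "?r ^ M \<le> ?r ^ (N + M)"
      using r by (auto intro!: power_increasing)
    then have "\<bar>x \<epsilon> + y \<epsilon>\<bar> \<le> 2 * ?r ^ (N + M)"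
      using elim(1,2) unfolding power_inverse by linarith
    also have "\<dots> \<le> ?r * ?r ^ (N + M)" using r elim by (intro mult_right_mono) auto
    finally show ?case by (simp add: power_inverse)
  qed
  then show ?thesis unfolding moderate_def by blast
qed

lemma moderate_mult:
  assumes g: "net_gauge \<rho>" and "moderate \<rho> x" "moderate \<rho> y"
  shows "moderate \<rho> (\<lambda>\<epsilon>. x \<epsilon> * y \<epsilon>)"
proof -
  obtain N M where N: "\<forall>\<^sub>F \<epsilon> in at_right 0. \<bar>x \<epsilon>\<bar> \<le> inverse (\<rho> \<epsilon> ^ N)"
    and M: "\<forall>\<^sub>F \<epsilon> in at_right 0. \<bar>y \<epsilon>\<bar> \<le> inverse (\<rho> \<epsilon> ^ M)"
    using assms unfolding moderate_def by auto
  have "\<forall>\<^sub>F \<epsilon> in at_right 0. \<bar>x \<epsilon> * y \<epsilon>\<bar> \<le> inverse (\<rho> \<epsilon> ^ (N + M))"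
    using N M net_gaugeD[OF g]
  proof eventually_elim
    case (elim \<epsilon>)
    then have "\<bar>x \<epsilon>\<bar> * \<bar>y \<epsilon>\<bar> \<le> inverse (\<rho> \<epsilon> ^ N) * inverse (\<rho> \<epsilon> ^ M)"
      by (intro mult_mono) auto
    then show ?case by (simp add: abs_mult power_add)
  qed
  then show ?thesis unfolding moderate_def by blast
qed

lemma moderate_uminus: "moderate \<rho> (\<lambda>\<epsilon>. - x \<epsilon>) \<longleftrightarrow> moderate \<rho> x"
  unfolding moderate_def by simp

lemma moderate_abs: "moderate \<rho> (\<lambda>\<epsilon>. \<bar>x \<epsilon>\<bar>) \<longleftrightarrow> moderate \<rho> x"
  unfolding moderate_def by simp

lemma moderate_const:
  assumes g: "net_gauge \<rho>"
  shows "moderate \<rho> (\<lambda>_. c)"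
proof -
  have "\<forall>\<^sub>F \<epsilon> in at_right 0. \<rho> \<epsilon> \<le> inverse (\<bar>c\<bar> + 1)"
    by (rule net_gauge_small[OF g]) simp
  with net_gaugeD[OF g] have "\<forall>\<^sub>F \<epsilon> in at_right 0. \<bar>c\<bar> \<le> inverse (\<rho> \<epsilon> ^ 1)"
  proof eventually_elim
    case (elim \<epsilon>)
    then have "inverse (inverse (\<bar>c\<bar> + 1)) \<le> inverse (\<rho> \<epsilon>)"
      by (intro le_imp_inverse_le) auto
    then show ?case by simp
  qed
  then show ?thesis unfolding moderate_def by blast
qed

lemma negligible_iff:
  "negligible_net \<rho> x \<longleftrightarrow> (\<forall>n::nat. \<forall>\<^sub>F \<epsilon> in at_right 0. \<bar>x \<epsilon>\<bar> \<le> \<rho> \<epsilon> ^ n)"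
  by (simp add: negligible_net_def net_equiv_def)

lemma net_equiv_iff: "net_equiv \<rho> x y \<longleftrightarrow> negligible_net \<rho> (\<lambda>\<epsilon>. x \<epsilon> - y \<epsilon>)"
  by (simp add: negligible_iff net_equiv_def)

lemma negligible_imp_moderate:
  assumes "net_gauge \<rho>" "negligible_net \<rho> x"
  shows "moderate \<rho> x"
proof -
  have "\<forall>\<^sub>F \<epsilon> in at_right 0. \<bar>x \<epsilon>\<bar> \<le> \<rho> \<epsilon> ^ 0" using assms(2) unfolding negligible_iff by blast
  then have "\<forall>\<^sub>F \<epsilon> in at_right 0. \<bar>x \<epsilon>\<bar> \<le> inverse (\<rho> \<epsilon> ^ 0)" by simp
  then show ?thesis unfolding moderate_def by blast
qed

lemma negligible_add:
  assumes g: "net_gauge \<rho>" and "negligible_net \<rho> x" "negligible_net \<rho> y"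
  shows "negligible_net \<rho> (\<lambda>\<epsilon>. x \<epsilon> + y \<epsilon>)"
  unfolding negligible_iff
proof
  fix n :: nat
  have "\<forall>\<^sub>F \<epsilon> in at_right 0. \<bar>x \<epsilon>\<bar> \<le> \<rho> \<epsilon> ^ Suc n" "\<forall>\<^sub>F \<epsilon> in at_right 0. \<bar>y \<epsilon>\<bar> \<le> \<rho> \<epsilon> ^ Suc n"
    using assms unfolding negligible_iff by blast+
  then show "\<forall>\<^sub>F \<epsilon> in at_right 0. \<bar>x \<epsilon> + y \<epsilon>\<bar> \<le> \<rho> \<epsilon> ^ n"
    using net_gaugeD[OF g] net_gauge_small[OF g, of "1/2", simplified]
  proof eventually_elim
    case (elim \<epsilon>)
    have "\<rho> \<epsilon> * \<rho> \<epsilon> ^ n \<le> 1/2 * \<rho> \<epsilon> ^ n" using elim by (intro mult_right_mono) auto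
    then show ?case using elim(1,2) unfolding power_Suc by linarith
  qed
qed

lemma negligible_mult:
  assumes g: "net_gauge \<rho>" and "negligible_net \<rho> x" "moderate \<rho> y"
  shows "negligible_net \<rho> (\<lambda>\<epsilon>. x \<epsilon> * y \<epsilon>)"
  unfolding negligible_iff
proof
  fix n :: nat
  obtain N where N: "\<forall>\<^sub>F \<epsilon> in at_right 0. \<bar>y \<epsilon>\<bar> \<le> inverse (\<rho> \<epsilon> ^ N)"
    using assms unfolding moderate_def by blast
  have "\<forall>\<^sub>F \<epsilon> in at_right 0. \<bar>x \<epsilon>\<bar> \<le> \<rho> \<epsilon> ^ (n + N)"
    using assms unfolding negligible_iff by blast
  then show "\<forall>\<^sub>F \<epsilon> in at_right 0. \<bar>x \<epsilon> * y \<epsilon>\<bar> \<le> \<rho> \<epsilon> ^ n"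
    using N net_gaugeD[OF g]
  proof eventually_elim
    case (elim \<epsilon>)
    have "\<bar>x \<epsilon>\<bar> * \<bar>y \<epsilon>\<bar> \<le> \<rho> \<epsilon> ^ (n + N) * inverse (\<rho> \<epsilon> ^ N)"
      using elim by (intro mult_mono) auto
    also have "\<dots> = \<rho> \<epsilon> ^ n" using elim by (simp add: power_add)
    finally show ?case by (simp add: abs_mult)
  qed
qed

lemma negligible_uminus: "negligible_net \<rho> (\<lambda>\<epsilon>. - x \<epsilon>) \<longleftrightarrow> negligible_net \<rho> x"
  unfolding negligible_iff by simp

lemma negligible_zero:
  assumes "net_gauge \<rho>"
  shows "negligible_net \<rho> (\<lambda>_. 0)"
  unfolding negligible_iff using net_gaugeD[OF assms] by (auto elim: eventually_mono)

lemma moderate_ring_cring: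
  assumes g: "net_gauge \<rho>"
  shows "cring (moderate_ring \<rho>)"
proof (rule cringI)
  show "abelian_group (moderate_ring \<rho>)"
  proof (rule abelian_groupI)
    fix x assume "x \<in> carrier (moderate_ring \<rho>)"
    then show "\<exists>y\<in>carrier (moderate_ring \<rho>). y \<oplus>\<^bsub>moderate_ring \<rho>\<^esub> x = \<zero>\<^bsub>moderate_ring \<rho>\<^esub>"
      by (intro bexI[of _ "\<lambda>\<epsilon>. - x \<epsilon>"]) (auto simp: moderate_ring_def moderate_uminus)
  qed (use g in \<open>auto simp: moderate_ring_def moderate_add moderate_const\<close>)
  show "comm_monoid (moderate_ring \<rho>)"
    by (rule comm_monoidI) (use g in \<open>auto simp: moderate_ring_def moderate_mult moderate_const\<close>)
qed (auto simp: moderate_ring_def algebra_simps)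

lemma moderate_ring_uminus:
  assumes g: "net_gauge \<rho>" and x: "moderate \<rho> x"
  shows "\<ominus>\<^bsub>moderate_ring \<rho>\<^esub> x = (\<lambda>\<epsilon>. - x \<epsilon>)"
proof -
  interpret cring "moderate_ring \<rho>" by (rule moderate_ring_cring[OF g])
  show ?thesis
    by (rule minus_equality) (use x in \<open>auto simp: moderate_ring_def moderate_uminus\<close>)
qed

lemma negligible_ideal:
  assumes g: "net_gauge \<rho>"
  shows "ideal {z. negligible_net \<rho> z} (moderate_ring \<rho>)"
proof -
  interpret cring "moderate_ring \<rho>" by (rule moderate_ring_cring[OF g])
  show ?thesis
  proof (rule idealI)
    show "ring (moderate_ring \<rho>)" by (rule ring_axioms)
    show "subgroup {z. negligible_net \<rho> z} (add_monoid (moderate_ring \<rho>))"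
    proof (rule add.subgroupI)
      fix a assume "a \<in> {z. negligible_net \<rho> z}"
      then show "\<ominus>\<^bsub>moderate_ring \<rho>\<^esub> a \<in> {z. negligible_net \<rho> z}"
        using moderate_ring_uminus[OF g, of a] negligible_imp_moderate[OF g, of a]
        by (simp add: negligible_uminus)
    qed (use negligible_zero[OF g] negligible_imp_moderate[OF g] negligible_add[OF g] in
         \<open>auto simp: moderate_ring_def\<close>)
  next
    fix a x assume "a \<in> {z. negligible_net \<rho> z}" "x \<in> carrier (moderate_ring \<rho>)"
    then have n: "negligible_net \<rho> (\<lambda>\<epsilon>. a \<epsilon> * x \<epsilon>)"
      using negligible_mult[OF g] by (auto simp: moderate_ring_def)
    show "x \<otimes>\<^bsub>moderate_ring \<rho>\<^esub> a \<in> {z. negligible_net \<rho> z}"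
      and "a \<otimes>\<^bsub>moderate_ring \<rho>\<^esub> x \<in> {z. negligible_net \<rho> z}"
      using n by (simp_all add: moderate_ring_def mult.commute)
  qed
qed

lemma gring_cring:
  assumes "net_gauge \<rho>"
  shows "cring (gring \<rho>)"
  unfolding gring_def
  by (rule ideal.quotient_is_cring[OF negligible_ideal[OF assms] moderate_ring_cring[OF assms]])

lemma gclass_eq_equiv_class: "gclass \<rho> x = {y. net_equiv \<rho> y x}"
proof -
  have "y \<in> gclass \<rho> x \<longleftrightarrow> negligible_net \<rho> (\<lambda>\<epsilon>. y \<epsilon> - x \<epsilon>)" for y
    unfolding gclass_def a_r_coset_def' by (force simp: moderate_ring_def)
  then show ?thesis by (auto simp: net_equiv_iff)
qed

lemma mem_gclass_iff: "y \<in> gclass \<rho> x \<longleftrightarrow> net_equiv \<rho> y x"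
  by (simp add: gclass_eq_equiv_class)

lemma net_equiv_refl: "net_gauge \<rho> \<Longrightarrow> net_equiv \<rho> x x"
  by (simp add: net_equiv_iff negligible_zero)

lemma net_equiv_sym: "net_equiv \<rho> x y \<Longrightarrow> net_equiv \<rho> y x"
  by (simp add: net_equiv_def abs_minus_commute)

lemma net_equiv_trans:
  assumes "net_gauge \<rho>" "net_equiv \<rho> x y" "net_equiv \<rho> y z"
  shows "net_equiv \<rho> x z"
  using negligible_add[OF assms(1), of "\<lambda>\<epsilon>. x \<epsilon> - y \<epsilon>" "\<lambda>\<epsilon>. y \<epsilon> - z \<epsilon>"] assms(2,3)
  by (simp add: net_equiv_iff)

lemma gclass_eq_iff:
  assumes "net_gauge \<rho>"
  shows "gclass \<rho> x = gclass \<rho> y \<longleftrightarrow> net_equiv \<rho> x y"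
  using net_equiv_refl[OF assms] net_equiv_sym net_equiv_trans[OF assms]
  unfolding gclass_eq_equiv_class set_eq_iff mem_Collect_eq by blast

lemma carrier_gring: "carrier (gring \<rho>) = gclass \<rho> ` {x. moderate \<rho> x}"
  by (auto simp: gring_def FactRing_def A_RCOSETS_def' gclass_def moderate_ring_def)

lemma gring_ops:
  assumes g: "net_gauge \<rho>" and x: "moderate \<rho> x" and y: "moderate \<rho> y"
  shows "gclass \<rho> x \<oplus>\<^bsub>gring \<rho>\<^esub> gclass \<rho> y = gclass \<rho> (\<lambda>\<epsilon>. x \<epsilon> + y \<epsilon>)"
    and "gclass \<rho> x \<otimes>\<^bsub>gring \<rho>\<^esub> gclass \<rho> y = gclass \<rho> (\<lambda>\<epsilon>. x \<epsilon> * y \<epsilon>)"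
    and "gclass \<rho> x \<ominus>\<^bsub>gring \<rho>\<^esub> gclass \<rho> y = gclass \<rho> (\<lambda>\<epsilon>. x \<epsilon> - y \<epsilon>)"
    and "\<zero>\<^bsub>gring \<rho>\<^esub> = gclass \<rho> (\<lambda>_. 0)"
    and "\<one>\<^bsub>gring \<rho>\<^esub> = gclass \<rho> (\<lambda>_. 1)"
proof -
  let ?M = "moderate_ring \<rho>" and ?R = "gring \<rho>"
  interpret ring_hom_cring ?M ?R "gclass \<rho>"
    using ideal.rcos_ring_hom_cring[OF negligible_ideal[OF g] moderate_ring_cring[OF g]]
    unfolding gring_def gclass_def[abs_def] by simp
  have xy: "x \<in> carrier ?M" "y \<in> carrier ?M" using x y by (simp_all add: moderate_ring_def)
  show "gclass \<rho> x \<oplus>\<^bsub>?R\<^esub> gclass \<rho> y = gclass \<rho> (\<lambda>\<epsilon>. x \<epsilon> + y \<epsilon>)"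
    using hom_add[OF xy] by (simp add: moderate_ring_def)
  show "gclass \<rho> x \<otimes>\<^bsub>?R\<^esub> gclass \<rho> y = gclass \<rho> (\<lambda>\<epsilon>. x \<epsilon> * y \<epsilon>)"
    using hom_mult[OF xy] by (simp add: moderate_ring_def)
  have "gclass \<rho> (\<ominus>\<^bsub>?M\<^esub> y) = \<ominus>\<^bsub>?R\<^esub> gclass \<rho> y" using xy by simp
  then have "gclass \<rho> x \<ominus>\<^bsub>?R\<^esub> gclass \<rho> y = gclass \<rho> (x \<oplus>\<^bsub>?M\<^esub> (\<ominus>\<^bsub>?M\<^esub> y))"
    using xy by (simp add: a_minus_def)
  then show "gclass \<rho> x \<ominus>\<^bsub>?R\<^esub> gclass \<rho> y = gclass \<rho> (\<lambda>\<epsilon>. x \<epsilon> - y \<epsilon>)"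
    by (simp add: moderate_ring_uminus[OF g y]) (simp add: moderate_ring_def)
  show "\<zero>\<^bsub>?R\<^esub> = gclass \<rho> (\<lambda>_. 0)" using hom_zero by (simp add: moderate_ring_def)
  show "\<one>\<^bsub>?R\<^esub> = gclass \<rho> (\<lambda>_. 1)" using hom_one by (simp add: moderate_ring_def)
qed

lemma gle_gclass:
  assumes g: "net_gauge \<rho>"
  shows "gle \<rho> (gclass \<rho> x) (gclass \<rho> y) \<longleftrightarrow>
    (\<exists>z. negligible_net \<rho> z \<and> (\<forall>\<^sub>F \<epsilon> in at_right 0. x \<epsilon> \<le> y \<epsilon> + z \<epsilon>))" (is "_ \<longleftrightarrow> ?R")
proof
  assume "gle \<rho> (gclass \<rho> x) (gclass \<rho> y)"
  then obtain x' y' z where *: "negligible_net \<rho> (\<lambda>\<epsilon>. x' \<epsilon> - x \<epsilon>)" "negligible_net \<rho> (\<lambda>\<epsilon>. y' \<epsilon> - y \<epsilon>)"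
      "negligible_net \<rho> z" and le: "\<forall>\<^sub>F \<epsilon> in at_right 0. x' \<epsilon> \<le> y' \<epsilon> + z \<epsilon>"
    unfolding gle_def by (auto simp: mem_gclass_iff net_equiv_iff)
  have "negligible_net \<rho> (\<lambda>\<epsilon>. (z \<epsilon> + (y' \<epsilon> - y \<epsilon>)) + - (x' \<epsilon> - x \<epsilon>))"
    using negligible_uminus[of \<rho> "\<lambda>\<epsilon>. x' \<epsilon> - x \<epsilon>"] * by (intro negligible_add[OF g]) auto
  moreover have "\<forall>\<^sub>F \<epsilon> in at_right 0. x \<epsilon> \<le> y \<epsilon> + ((z \<epsilon> + (y' \<epsilon> - y \<epsilon>)) + - (x' \<epsilon> - x \<epsilon>))"
    using le by (auto elim: eventually_mono)
  ultimately show ?R by blast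
next
  assume ?R
  then show "gle \<rho> (gclass \<rho> x) (gclass \<rho> y)"
    unfolding gle_def using net_equiv_refl[OF g]
    by (intro bexI[of _ x] bexI[of _ y]) (auto simp: mem_gclass_iff)
qed

lemma UN_gclass_const:
  assumes "net_gauge \<rho>" "\<And>y. net_equiv \<rho> y x \<Longrightarrow> net_equiv \<rho> (h y) (h x)"
  shows "(\<Union>y\<in>gclass \<rho> x. gclass \<rho> (h y)) = gclass \<rho> (h x)"
proof -
  have "gclass \<rho> (h y) = gclass \<rho> (h x)" if "y \<in> gclass \<rho> x" for y
    using that assms by (simp add: gclass_eq_iff mem_gclass_iff)
  moreover have "x \<in> gclass \<rho> x" using assms(1) by (simp add: mem_gclass_iff net_equiv_refl)
  ultimately show ?thesis by blast
qed

lemma gabs_gclass: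
  assumes g: "net_gauge \<rho>"
  shows "gabs \<rho> (gclass \<rho> x) = gclass \<rho> (\<lambda>\<epsilon>. \<bar>x \<epsilon>\<bar>)"
  unfolding gabs_def
proof (rule UN_gclass_const[OF g])
  fix y assume y: "net_equiv \<rho> y x"
  show "net_equiv \<rho> (\<lambda>\<epsilon>. \<bar>y \<epsilon>\<bar>) (\<lambda>\<epsilon>. \<bar>x \<epsilon>\<bar>)"
    unfolding net_equiv_def
  proof
    fix n :: nat
    from y have "\<forall>\<^sub>F \<epsilon> in at_right 0. \<bar>y \<epsilon> - x \<epsilon>\<bar> \<le> \<rho> \<epsilon> ^ n" unfolding net_equiv_def by blast
    then show "\<forall>\<^sub>F \<epsilon> in at_right 0. \<bar>\<bar>y \<epsilon>\<bar> - \<bar>x \<epsilon>\<bar>\<bar> \<le> \<rho> \<epsilon> ^ n"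
      by eventually_elim linarith
  qed
qed

lemma empty_notin_gring: "net_gauge \<rho> \<Longrightarrow> {} \<notin> carrier (gring \<rho>)"
  using net_equiv_refl by (fastforce simp: carrier_gring mem_gclass_iff set_eq_iff)

end

theory Submission
  imports Defs
begin

text \<open>
  Since the lower derivatives vanish at \<open>l\<close> and \<open>m\<close>, Taylor's formula gives, up to negligible
  nets, \<open>f\<^sup>(\<^sup>j\<^sup>)(x\<^sub>n) = f\<^sup>(\<^sup>k\<^sup>)(\<xi>\<^sub>n) (x\<^sub>n - l)^(k - j) / (k - j)!\<close> with \<open>\<xi>\<^sub>n\<close> between \<open>l\<close> and \<open>x\<^sub>n\<close>, and
  likewise \<open>g\<^sup>(\<^sup>j\<^sup>)(y\<^sub>n)\<close>. In the quotient the factorials cancel, the powers contribute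
  \<open>C^(k - j)\<close>, and the remaining factor tends to \<open>L = f\<^sup>(\<^sup>k\<^sup>)(l) / g\<^sup>(\<^sup>k\<^sup>)(m)\<close> because derivatives of
  generalized smooth functions are continuous in the sharp topology. That continuity comes from
  a uniform moderate bound for the next derivative near the limit point.
\<close>

section \<open>Nets, classes and ring operations on representatives\<close>

lemma eventually_unit_interval: "\<forall>\<^sub>F \<epsilon> in at_right 0. \<epsilon> \<in> {0<..1::real}"
  unfolding eventually_small_iff by (intro bexI[of _ 1]) auto

lemma moderateI_le:
  assumes "net_gauge \<rho>" "moderate \<rho> y" "\<forall>\<^sub>F \<epsilon> in at_right 0. \<bar>x \<epsilon>\<bar> \<le> \<bar>y \<epsilon>\<bar>"
  shows "moderate \<rho> x"
proof -
  obtain N where "\<forall>\<^sub>F \<epsilon> in at_right 0. \<bar>y \<epsilon>\<bar> \<le> inverse (\<rho> \<epsilon> ^ N)"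
    using assms(2) unfolding moderate_def by blast
  with assms(3) have "\<forall>\<^sub>F \<epsilon> in at_right 0. \<bar>x \<epsilon>\<bar> \<le> inverse (\<rho> \<epsilon> ^ N)"
    by eventually_elim linarith
  then show ?thesis unfolding moderate_def by blast
qed

lemma moderate_gauge:
  assumes "net_gauge \<rho>"
  shows "moderate \<rho> \<rho>"
  by (rule moderateI_le[OF assms moderate_const[OF assms, of 1]])
     (use net_gaugeD[OF assms] in eventually_elim, auto)

lemma moderate_diff:
  assumes "net_gauge \<rho>" "moderate \<rho> x" "moderate \<rho> y"
  shows "moderate \<rho> (\<lambda>\<epsilon>. x \<epsilon> - y \<epsilon>)"
  using moderate_add[OF assms(1,2), of "\<lambda>\<epsilon>. - y \<epsilon>"] assms(3) by (simp add: moderate_uminus)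

lemma moderate_power:
  assumes "net_gauge \<rho>" "moderate \<rho> x"
  shows "moderate \<rho> (\<lambda>\<epsilon>. x \<epsilon> ^ p)"
  by (induction p) (use assms in \<open>auto intro: moderate_mult moderate_const\<close>)

lemma negligible_sum:
  assumes "net_gauge \<rho>" "\<And>i. i \<in> A \<Longrightarrow> negligible_net \<rho> (x i)"
  shows "negligible_net \<rho> (\<lambda>\<epsilon>. \<Sum>i\<in>A. x i \<epsilon>)"
  using assms(2) by (induction A rule: infinite_finite_induct)
    (use assms(1) in \<open>auto intro: negligible_add negligible_zero\<close>)

lemma gclass_eqI_eventually:
  assumes "net_gauge \<rho>" "\<forall>\<^sub>F \<epsilon> in at_right 0. x \<epsilon> = y \<epsilon>"
  shows "gclass \<rho> x = gclass \<rho> y"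
proof -
  have "\<forall>\<^sub>F \<epsilon> in at_right 0. \<bar>x \<epsilon> - y \<epsilon>\<bar> \<le> \<rho> \<epsilon> ^ n" for n
    using assms(2) net_gaugeD[OF assms(1)] by eventually_elim simp
  then show ?thesis using assms(1) by (simp add: gclass_eq_iff net_equiv_def)
qed

text \<open>Negligible nets are moderate, so every representative of an element of the carrier is
  moderate. Since \<open>gclass\<close> is defined for arbitrary nets, this is how moderateness is
  read off from membership in the ring.\<close>

lemma gclass_in_carrier_iff:
  assumes "net_gauge \<rho>"
  shows "gclass \<rho> x \<in> carrier (gring \<rho>) \<longleftrightarrow> moderate \<rho> x"
proof
  assume "gclass \<rho> x \<in> carrier (gring \<rho>)"
  then obtain y where y: "moderate \<rho> y" "net_equiv \<rho> x y"
    using assms by (auto simp: carrier_gring gclass_eq_iff)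
  then have "moderate \<rho> (\<lambda>\<epsilon>. (x \<epsilon> - y \<epsilon>) + y \<epsilon>)"
    using assms moderate_add[OF assms negligible_imp_moderate[OF assms] y(1)]
    by (simp only: net_equiv_iff)
  then show "moderate \<rho> x" by simp
qed (auto simp: carrier_gring)

lemma gring_carrierE:
  assumes "X \<in> carrier (gring \<rho>)"
  obtains x where "moderate \<rho> x" "X = gclass \<rho> x"
  using assms by (auto simp: carrier_gring)

lemma gring_pow:
  assumes "net_gauge \<rho>" "moderate \<rho> x"
  shows "gclass \<rho> x [^]\<^bsub>gring \<rho>\<^esub> (p::nat) = gclass \<rho> (\<lambda>\<epsilon>. x \<epsilon> ^ p)"
proof -
  interpret cring "gring \<rho>" by (rule gring_cring[OF assms(1)])
  show ?thesis
    by (induction p)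
       (use assms gring_ops[OF assms assms(2)] in
         \<open>simp_all add: nat_pow_def gring_ops(2) moderate_power mult.commute\<close>)
qed

lemma gauge_power_mono:
  assumes "net_gauge \<rho>" "a \<le> b"
  shows "\<forall>\<^sub>F \<epsilon> in at_right 0. \<rho> \<epsilon> ^ b \<le> \<rho> \<epsilon> ^ a"
  using net_gaugeD[OF assms(1)] by eventually_elim (use assms(2) in \<open>auto intro: power_decreasing\<close>)

section \<open>Invertibility, quotients and strict order on representatives\<close>

text \<open>The representative form of invertibility, as \<open>gclass_Units_iff\<close> shows: a
  fixed power of the gauge as lower bound is what makes the reciprocal moderate.\<close>

definition bounded_away :: "net \<Rightarrow> net \<Rightarrow> bool" where
  "bounded_away \<rho> x \<longleftrightarrow> (\<exists>p::nat. \<forall>\<^sub>F \<epsilon> in at_right 0. \<rho> \<epsilon> ^ p \<le> \<bar>x \<epsilon>\<bar>)"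

lemma bounded_away_inverse:
  assumes g: "net_gauge \<rho>" and "bounded_away \<rho> x"
  shows "moderate \<rho> (\<lambda>\<epsilon>. inverse (x \<epsilon>))"
proof -
  obtain p where "\<forall>\<^sub>F \<epsilon> in at_right 0. \<rho> \<epsilon> ^ p \<le> \<bar>x \<epsilon>\<bar>"
    using assms(2) unfolding bounded_away_def by blast
  with net_gaugeD[OF g] have "\<forall>\<^sub>F \<epsilon> in at_right 0. \<bar>inverse (x \<epsilon>)\<bar> \<le> inverse (\<rho> \<epsilon> ^ p)"
    by eventually_elim (auto simp: abs_inverse intro!: le_imp_inverse_le)
  then show ?thesis unfolding moderate_def by blast
qed

lemma bounded_away_nonzero:
  assumes g: "net_gauge \<rho>" and "bounded_away \<rho> x"
  shows "\<forall>\<^sub>F \<epsilon> in at_right 0. x \<epsilon> \<noteq> 0"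
proof -
  obtain p where "\<forall>\<^sub>F \<epsilon> in at_right 0. \<rho> \<epsilon> ^ p \<le> \<bar>x \<epsilon>\<bar>"
    using assms(2) unfolding bounded_away_def by blast
  with net_gaugeD[OF g] show ?thesis
  proof eventually_elim
    case (elim \<epsilon>)
    then have "0 < \<rho> \<epsilon> ^ p" by simp
    with elim(2) have "0 < \<bar>x \<epsilon>\<bar>" by (rule less_le_trans[rotated])
    then show ?case by simp
  qed
qed

lemma gclass_mult_inverse:
  assumes g: "net_gauge \<rho>" and x: "moderate \<rho> x" and "bounded_away \<rho> x"
  shows "gclass \<rho> x \<otimes>\<^bsub>gring \<rho>\<^esub> gclass \<rho> (\<lambda>\<epsilon>. inverse (x \<epsilon>)) = \<one>\<^bsub>gring \<rho>\<^esub>"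
proof -
  have "gclass \<rho> (\<lambda>\<epsilon>. x \<epsilon> * inverse (x \<epsilon>)) = gclass \<rho> (\<lambda>_. 1)"
    by (rule gclass_eqI_eventually[OF g])
       (use bounded_away_nonzero[OF g assms(3)] in eventually_elim, simp)
  then show ?thesis
    using gring_ops(2)[OF g x bounded_away_inverse[OF g assms(3)]] gring_ops(5)[OF g x x] by simp
qed

text \<open>If \<open>x y\<close> equals 1 up to \<open>\<rho>\<close>, then
  \<open>|x y| \<ge> 1 - \<rho> \<ge> \<rho>\<close> once \<open>\<rho> \<le> 1/2\<close>, and the
  bound \<open>\<rho>^-N\<close> on \<open>y\<close> leaves \<open>|x| \<ge> \<rho>^(N+1)\<close>.
  Conversely, the pointwise reciprocal is moderate and represents the inverse.\<close>

lemma gclass_Units_iff: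
  assumes g: "net_gauge \<rho>" and x: "moderate \<rho> x"
  shows "gclass \<rho> x \<in> Units (gring \<rho>) \<longleftrightarrow> bounded_away \<rho> x"
proof
  assume "gclass \<rho> x \<in> Units (gring \<rho>)"
  then obtain Y where "Y \<in> carrier (gring \<rho>)" "gclass \<rho> x \<otimes>\<^bsub>gring \<rho>\<^esub> Y = \<one>\<^bsub>gring \<rho>\<^esub>"
    unfolding Units_def by auto
  then obtain y where y: "moderate \<rho> y" "gclass \<rho> x \<otimes>\<^bsub>gring \<rho>\<^esub> gclass \<rho> y = \<one>\<^bsub>gring \<rho>\<^esub>"
    by (auto elim: gring_carrierE)
  have "net_equiv \<rho> (\<lambda>\<epsilon>. x \<epsilon> * y \<epsilon>) (\<lambda>_. 1)"
    using y(2) unfolding gring_ops(2)[OF g x y(1)] gring_ops(5)[OF g x x] gclass_eq_iff[OF g] .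
  then have "\<forall>\<^sub>F \<epsilon> in at_right 0. \<bar>x \<epsilon> * y \<epsilon> - 1\<bar> \<le> \<rho> \<epsilon> ^ 1" unfolding net_equiv_def by blast
  moreover obtain N where "\<forall>\<^sub>F \<epsilon> in at_right 0. \<bar>y \<epsilon>\<bar> \<le> inverse (\<rho> \<epsilon> ^ N)"
    using y(1) unfolding moderate_def by blast
  ultimately have "\<forall>\<^sub>F \<epsilon> in at_right 0. \<rho> \<epsilon> ^ Suc N \<le> \<bar>x \<epsilon>\<bar>"
    using net_gaugeD[OF g] net_gauge_small[OF g, of "1/2", simplified]
  proof eventually_elim
    case (elim \<epsilon>)
    have pos: "0 < \<rho> \<epsilon> ^ N" using elim by simp
    have "\<rho> \<epsilon> \<le> \<bar>x \<epsilon> * y \<epsilon>\<bar>"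
      using elim(1,4) unfolding power_one_right by linarith
    also have "\<dots> \<le> \<bar>x \<epsilon>\<bar> * inverse (\<rho> \<epsilon> ^ N)"
      using elim by (simp add: abs_mult mult_left_mono)
    finally show ?case using pos by (simp add: field_simps)
  qed
  then show "bounded_away \<rho> x" unfolding bounded_away_def by blast
next
  interpret cring "gring \<rho>" by (rule gring_cring[OF g])
  assume b: "bounded_away \<rho> x"
  have carr: "gclass \<rho> x \<in> carrier (gring \<rho>)"
    "gclass \<rho> (\<lambda>\<epsilon>. inverse (x \<epsilon>)) \<in> carrier (gring \<rho>)"
    using bounded_away_inverse[OF g b] x by (simp_all add: gclass_in_carrier_iff[OF g])
  show "gclass \<rho> x \<in> Units (gring \<rho>)"
    using carr gclass_mult_inverse[OF g x b] m_comm[OF carr] unfolding Units_def by force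
qed

text \<open>A net that is bounded away from zero is eventually nonzero, so the value 0 that division
  by zero yields does not affect the class of the pointwise quotient.\<close>

lemma gdiv_gclass:
  assumes g: "net_gauge \<rho>" and x: "moderate \<rho> x" and y: "moderate \<rho> y" "bounded_away \<rho> y"
  shows "gdiv \<rho> (gclass \<rho> x) (gclass \<rho> y) = gclass \<rho> (\<lambda>\<epsilon>. x \<epsilon> / y \<epsilon>)"
proof -
  interpret cring "gring \<rho>" by (rule gring_cring[OF g])
  have "inv\<^bsub>gring \<rho>\<^esub> gclass \<rho> y = gclass \<rho> (\<lambda>\<epsilon>. inverse (y \<epsilon>))"
    using gclass_mult_inverse[OF g y] bounded_away_inverse[OF g y(2)] y(1)
    by (intro comm_inv_char) (auto simp: gclass_in_carrier_iff[OF g])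
  then show ?thesis
    using gclass_Units_iff[OF g y(1)] y(2) gring_ops(2)[OF g x bounded_away_inverse[OF g y(2)]]
    by (simp add: gdiv_def divide_inverse)
qed

text \<open>Order together with an invertible difference leaves a gap of one fixed power of the
  gauge, now with a definite sign. This turns strict inequalities of classes into eventual
  inequalities of nets.\<close>

lemma glt_gclass_iff:
  assumes g: "net_gauge \<rho>" and x: "moderate \<rho> x" and y: "moderate \<rho> y"
  shows "glt \<rho> (gclass \<rho> x) (gclass \<rho> y) \<longleftrightarrow>
    (\<exists>p::nat. \<forall>\<^sub>F \<epsilon> in at_right 0. x \<epsilon> + \<rho> \<epsilon> ^ p \<le> y \<epsilon>)"
proof -
  have "glt \<rho> (gclass \<rho> x) (gclass \<rho> y) \<longleftrightarrow>
    (\<exists>z. negligible_net \<rho> z \<and> (\<forall>\<^sub>F \<epsilon> in at_right 0. x \<epsilon> \<le> y \<epsilon> + z \<epsilon>)) \<and>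
    bounded_away \<rho> (\<lambda>\<epsilon>. y \<epsilon> - x \<epsilon>)"
    unfolding glt_def gle_gclass[OF g] gring_ops(3)[OF g y x]
      gclass_Units_iff[OF g moderate_diff[OF g y x]] ..
  also have "\<dots> \<longleftrightarrow> (\<exists>p::nat. \<forall>\<^sub>F \<epsilon> in at_right 0. x \<epsilon> + \<rho> \<epsilon> ^ p \<le> y \<epsilon>)"
  proof safe
    fix z assume z: "negligible_net \<rho> z" "\<forall>\<^sub>F \<epsilon> in at_right 0. x \<epsilon> \<le> y \<epsilon> + z \<epsilon>"
      and "bounded_away \<rho> (\<lambda>\<epsilon>. y \<epsilon> - x \<epsilon>)"
    then obtain p where p: "\<forall>\<^sub>F \<epsilon> in at_right 0. \<rho> \<epsilon> ^ p \<le> \<bar>y \<epsilon> - x \<epsilon>\<bar>"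
      unfolding bounded_away_def by blast
    \<comment> \<open>The exponent \<open>Suc p\<close> makes the error \<open>z \<epsilon>\<close>
      smaller than the gap \<open>\<rho> \<epsilon> ^ p\<close>, which rules out that
      \<open>y \<epsilon> - x \<epsilon>\<close> is at most
      \<open>- (\<rho> \<epsilon> ^ p)\<close>.\<close>
    have "\<forall>\<^sub>F \<epsilon> in at_right 0. \<bar>z \<epsilon>\<bar> \<le> \<rho> \<epsilon> ^ Suc p" using z unfolding negligible_iff by blast
    with z(2) p net_gaugeD[OF g] net_gauge_small[OF g, of "1/2", simplified]
    have "\<forall>\<^sub>F \<epsilon> in at_right 0. x \<epsilon> + \<rho> \<epsilon> ^ p \<le> y \<epsilon>"
    proof eventually_elim
      case (elim \<epsilon>)
      have "\<rho> \<epsilon> * \<rho> \<epsilon> ^ p \<le> 1/2 * \<rho> \<epsilon> ^ p" "0 < \<rho> \<epsilon> ^ p" using elim by (auto intro: mult_right_mono)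
      then show ?case using elim unfolding power_Suc by (simp only: abs_le_iff) linarith
    qed
    then show "\<exists>p::nat. \<forall>\<^sub>F \<epsilon> in at_right 0. x \<epsilon> + \<rho> \<epsilon> ^ p \<le> y \<epsilon>" by blast
  next
    fix p :: nat assume "\<forall>\<^sub>F \<epsilon> in at_right 0. x \<epsilon> + \<rho> \<epsilon> ^ p \<le> y \<epsilon>"
    with net_gaugeD[OF g]
    have ev: "\<forall>\<^sub>F \<epsilon> in at_right 0. \<rho> \<epsilon> ^ p \<le> \<bar>y \<epsilon> - x \<epsilon>\<bar> \<and> x \<epsilon> \<le> y \<epsilon> + 0"
    proof eventually_elim
      case (elim \<epsilon>)
      have "0 < \<rho> \<epsilon> ^ p" using elim by simp
      with elim show ?case by linarith
    qed
    show "\<exists>z. negligible_net \<rho> z \<and> (\<forall>\<^sub>F \<epsilon> in at_right 0. x \<epsilon> \<le> y \<epsilon> + z \<epsilon>)"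
      using ev by (intro exI[of _ "\<lambda>_. 0"]) (auto simp: negligible_zero[OF g] elim: eventually_mono)
    show "bounded_away \<rho> (\<lambda>\<epsilon>. y \<epsilon> - x \<epsilon>)"
      unfolding bounded_away_def using ev by (auto elim: eventually_mono)
  qed
  finally show ?thesis .
qed

section \<open>Neighbourhoods in the sharp topology\<close>

text \<open>Induction over the topology generated by the balls: intersections add the exponents,
  unions keep the exponent of one member, and a ball leaves room around each of its points. The nets
  \<open>x\<close> in the conclusion are moderate because they are close to
  \<open>a\<close>.\<close>

lemma openin_sharp_topologyD:
  assumes g: "net_gauge \<rho>" and "openin (sharp_topology \<rho>) U"
    and "gclass \<rho> a \<in> U" and a: "moderate \<rho> a"
  obtains q :: nat where
    "\<And>x. \<forall>\<^sub>F \<epsilon> in at_right 0. \<bar>x \<epsilon> - a \<epsilon>\<bar> \<le> \<rho> \<epsilon> ^ q \<Longrightarrow> gclass \<rho> x \<in> U"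
proof -
  let ?near = "\<lambda>q V. \<forall>x. (\<forall>\<^sub>F \<epsilon> in at_right 0. \<bar>x \<epsilon> - a \<epsilon>\<bar> \<le> \<rho> \<epsilon> ^ q) \<longrightarrow> gclass \<rho> x \<in> V"
  have "generate_topology_on {sharp_ball \<rho> x r | x r. x \<in> carrier (gring \<rho>) \<and> r \<in> carrier (gring \<rho>) \<and>
      glt \<rho> \<zero>\<^bsub>gring \<rho>\<^esub> r} U"
    using assms(2) unfolding sharp_topology_def openin_topology_generated_by_iff .
  then have "gclass \<rho> a \<in> U \<longrightarrow> (\<exists>q::nat. ?near q U)"
  proof induction
    case Empty
    then show ?case by simp
  next
    case (Int V W)
    show ?case
    proof
      assume "gclass \<rho> a \<in> V \<inter> W"
      then obtain q r where q: "?near q V" and r: "?near r W" using Int.IH by blast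
      have "?near (q + r) (V \<inter> W)"
      proof (intro allI impI)
        fix x assume x: "\<forall>\<^sub>F \<epsilon> in at_right 0. \<bar>x \<epsilon> - a \<epsilon>\<bar> \<le> \<rho> \<epsilon> ^ (q + r)"
        have "\<forall>\<^sub>F \<epsilon> in at_right 0. \<bar>x \<epsilon> - a \<epsilon>\<bar> \<le> \<rho> \<epsilon> ^ q"
          using x gauge_power_mono[OF g le_add1[of q r]] by eventually_elim linarith
        moreover have "\<forall>\<^sub>F \<epsilon> in at_right 0. \<bar>x \<epsilon> - a \<epsilon>\<bar> \<le> \<rho> \<epsilon> ^ r"
          using x gauge_power_mono[OF g le_add2[of r q]] by eventually_elim linarith
        ultimately show "gclass \<rho> x \<in> V \<inter> W" using q r by blast
      qed
      then show "\<exists>q. ?near q (V \<inter> W)" by blast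
    qed
  next
    case (UN K)
    show ?case
    proof
      assume "gclass \<rho> a \<in> \<Union>K"
      then obtain V where V: "V \<in> K" "gclass \<rho> a \<in> V" by blast
      then obtain q where "?near q V" using UN.IH by blast
      then have "?near q (\<Union>K)" using V(1) by blast
      then show "\<exists>q. ?near q (\<Union>K)" by blast
    qed
  next
    case (Basis V)
    then obtain c' r' where c': "c' \<in> carrier (gring \<rho>)" and r': "r' \<in> carrier (gring \<rho>)"
      and V': "V = sharp_ball \<rho> c' r'"
      by blast
    obtain c where c: "moderate \<rho> c" "c' = gclass \<rho> c" using c' by (rule gring_carrierE)
    obtain r where r: "moderate \<rho> r" "r' = gclass \<rho> r" using r' by (rule gring_carrierE)
    note V = V'[unfolded c(2) r(2)]
    have in_V: "gclass \<rho> x \<in> V \<longleftrightarrow> (\<exists>p::nat. \<forall>\<^sub>F \<epsilon> in at_right 0. \<bar>x \<epsilon> - c \<epsilon>\<bar> + \<rho> \<epsilon> ^ p \<le> r \<epsilon>)"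
      if x: "moderate \<rho> x" for x
      using x glt_gclass_iff[OF g _ r(1), of "\<lambda>\<epsilon>. \<bar>x \<epsilon> - c \<epsilon>\<bar>"] moderate_diff[OF g x c(1)]
      by (simp add: V sharp_ball_def gclass_in_carrier_iff[OF g] gring_ops(3)[OF g x c(1)]
          gabs_gclass[OF g] moderate_abs)
    show ?case
    proof
      assume "gclass \<rho> a \<in> V"
      then obtain p where p: "\<forall>\<^sub>F \<epsilon> in at_right 0. \<bar>a \<epsilon> - c \<epsilon>\<bar> + \<rho> \<epsilon> ^ p \<le> r \<epsilon>"
        using in_V[OF a] by blast
      \<comment> \<open>Membership of \<open>a\<close> leaves the gap
        \<open>\<rho> \<epsilon> ^ p\<close> below the radius. A deviation of at most
        \<open>\<rho> \<epsilon> ^ Suc p\<close> uses up to half of it, and the other half provides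
        the gap required for \<open>x\<close>.\<close>
      have "gclass \<rho> x \<in> V" if x: "\<forall>\<^sub>F \<epsilon> in at_right 0. \<bar>x \<epsilon> - a \<epsilon>\<bar> \<le> \<rho> \<epsilon> ^ Suc p" for x
      proof -
        have "moderate \<rho> (\<lambda>\<epsilon>. x \<epsilon> - a \<epsilon>)"
          by (rule moderateI_le[OF g moderate_power[OF g moderate_gauge[OF g], of "Suc p"]])
             (use x in eventually_elim, auto)
        from moderate_add[OF g this a] have m: "moderate \<rho> x" by simp
        have "\<forall>\<^sub>F \<epsilon> in at_right 0. \<bar>x \<epsilon> - c \<epsilon>\<bar> + \<rho> \<epsilon> ^ Suc p \<le> r \<epsilon>"
          using x p net_gaugeD[OF g] net_gauge_small[OF g, of "1/2", simplified]
        proof eventually_elim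
          case (elim \<epsilon>)
          have "\<rho> \<epsilon> * \<rho> \<epsilon> ^ p \<le> 1/2 * \<rho> \<epsilon> ^ p" using elim by (intro mult_right_mono) auto
          then show ?case using elim(1,2) unfolding power_Suc by linarith
        qed
        then show ?thesis unfolding in_V[OF m] by blast
      qed
      then show "\<exists>q. ?near q V" by blast
    qed
  qed
  then show thesis using assms(3) that by blast
qed

section \<open>Taylor's formula and local bounds for derivatives\<close>

lemma smooth_fun_DERIV:
  assumes "smooth_fun h"
  shows "((deriv ^^ j) h has_real_derivative (deriv ^^ Suc j) h x) (at x)"
  using assms by (simp add: smooth_fun_def DERIV_deriv_iff_real_differentiable)

text \<open>Maclaurin's formula with Lagrange remainder, applied to the translate of
  \<open>(deriv ^^ j) h\<close> by \<open>c\<close>. The weak bound on \<open>t\<close> also covers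
  \<open>x = c\<close> and the empty sum for \<open>p = 0\<close>; the latter is the case of the
  derivative of top order.\<close>

lemma smooth_fun_taylor:
  assumes "smooth_fun h"
  shows "\<exists>t. \<bar>t - c\<bar> \<le> \<bar>x - c\<bar> \<and> (deriv ^^ j) h x =
    (\<Sum>i<p. (deriv ^^ (j + i)) h c / fact i * (x - c) ^ i) + (deriv ^^ (j + p)) h t / fact p * (x - c) ^ p"
proof -
  have "((\<lambda>s. (deriv ^^ (j + i)) h (s + c)) has_real_derivative (deriv ^^ (j + Suc i)) h (s + c)) (at s)"
    for i s
    using smooth_fun_DERIV[OF assms, of "j + i" "s + c"] by (simp add: DERIV_shift)
  then obtain t where "\<bar>t\<bar> \<le> \<bar>x - c\<bar>" "(deriv ^^ j) h (x - c + c) =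
    (\<Sum>i<p. (deriv ^^ (j + i)) h (0 + c) / fact i * (x - c) ^ i)
      + (deriv ^^ (j + p)) h (t + c) / fact p * (x - c) ^ p"
    using Maclaurin_all_le[of "\<lambda>i s. (deriv ^^ (j + i)) h (s + c)" "\<lambda>s. (deriv ^^ j) h (s + c)" "x - c" p]
    by auto
  then show ?thesis by (intro exI[of _ "t + c"]) auto
qed

text \<open>
  The \<open>j\<close>-th derivative is moderate along a net of points that maximise its absolute value on
  the intervals of radius \<open>\<rho> \<epsilon> ^ q\<close>; this bounds it uniformly on these intervals.
\<close>

lemma defining_net_bound:
  assumes g: "net_gauge \<rho>" and F: "defining_net \<rho> U f F" and a: "moderate \<rho> a"
    and near: "\<And>x. \<forall>\<^sub>F \<epsilon> in at_right 0. \<bar>x \<epsilon> - a \<epsilon>\<bar> \<le> \<rho> \<epsilon> ^ q \<Longrightarrow> gclass \<rho> x \<in> U"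
  shows "\<exists>N::nat. \<forall>\<^sub>F \<epsilon> in at_right 0. \<forall>t. \<bar>t - a \<epsilon>\<bar> \<le> \<rho> \<epsilon> ^ q \<longrightarrow>
    \<bar>(deriv ^^ j) (F \<epsilon>) t\<bar> \<le> inverse (\<rho> \<epsilon> ^ N)"
proof -
  have "\<exists>x. \<bar>x - a \<epsilon>\<bar> \<le> \<rho> \<epsilon> ^ q \<and>
      (\<forall>t. \<bar>t - a \<epsilon>\<bar> \<le> \<rho> \<epsilon> ^ q \<longrightarrow> \<bar>(deriv ^^ j) (F \<epsilon>) t\<bar> \<le> \<bar>(deriv ^^ j) (F \<epsilon>) x\<bar>)"
    if "\<epsilon> \<in> {0<..1}" for \<epsilon>
  proof -
    have "0 \<le> \<rho> \<epsilon> ^ q" using g that unfolding net_gauge_def by (simp add: less_imp_le)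
    moreover have "smooth_fun (F \<epsilon>)" using F that unfolding defining_net_def by blast
    then have "continuous_on (cball (a \<epsilon>) (\<rho> \<epsilon> ^ q)) (\<lambda>t. \<bar>(deriv ^^ j) (F \<epsilon>) t\<bar>)"
      using smooth_fun_DERIV
      by (intro continuous_intros continuous_at_imp_continuous_on ballI) (blast intro: DERIV_isCont)
    ultimately obtain x where "x \<in> cball (a \<epsilon>) (\<rho> \<epsilon> ^ q)"
      "\<forall>t\<in>cball (a \<epsilon>) (\<rho> \<epsilon> ^ q). \<bar>(deriv ^^ j) (F \<epsilon>) t\<bar> \<le> \<bar>(deriv ^^ j) (F \<epsilon>) x\<bar>"
      using continuous_attains_sup[of "cball (a \<epsilon>) (\<rho> \<epsilon> ^ q)" "\<lambda>t. \<bar>(deriv ^^ j) (F \<epsilon>) t\<bar>"]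
      by (metis cball_eq_empty compact_cball not_less)
    then show ?thesis by (auto simp: dist_real_def abs_minus_commute)
  qed
  then obtain x where x: "\<And>\<epsilon>. \<epsilon> \<in> {0<..1} \<Longrightarrow> \<bar>x \<epsilon> - a \<epsilon>\<bar> \<le> \<rho> \<epsilon> ^ q \<and>
      (\<forall>t. \<bar>t - a \<epsilon>\<bar> \<le> \<rho> \<epsilon> ^ q \<longrightarrow> \<bar>(deriv ^^ j) (F \<epsilon>) t\<bar> \<le> \<bar>(deriv ^^ j) (F \<epsilon>) (x \<epsilon>)\<bar>)"
    by metis
  note unit = eventually_unit_interval
  then have ev: "\<forall>\<^sub>F \<epsilon> in at_right 0. \<bar>x \<epsilon> - a \<epsilon>\<bar> \<le> \<rho> \<epsilon> ^ q"
    by eventually_elim (use x in blast)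
  have "moderate \<rho> (\<lambda>\<epsilon>. x \<epsilon> - a \<epsilon>)"
    by (rule moderateI_le[OF g moderate_power[OF g moderate_gauge[OF g], of q]])
       (use ev in eventually_elim, auto)
  from moderate_add[OF g this a] have "moderate \<rho> x" by simp
  then have "moderate \<rho> (\<lambda>\<epsilon>. (deriv ^^ j) (F \<epsilon>) (x \<epsilon>))"
    using F near[OF ev] unfolding defining_net_def by blast
  then obtain N where "\<forall>\<^sub>F \<epsilon> in at_right 0. \<bar>(deriv ^^ j) (F \<epsilon>) (x \<epsilon>)\<bar> \<le> inverse (\<rho> \<epsilon> ^ N)"
    unfolding moderate_def by blast
  with unit have "\<forall>\<^sub>F \<epsilon> in at_right 0. \<forall>t. \<bar>t - a \<epsilon>\<bar> \<le> \<rho> \<epsilon> ^ q \<longrightarrow>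
      \<bar>(deriv ^^ j) (F \<epsilon>) t\<bar> \<le> inverse (\<rho> \<epsilon> ^ N)"
    by eventually_elim (use x order_trans in blast)
  then show ?thesis by blast
qed

text \<open>Taylor's formula with \<open>p = 1\<close>, that is, the mean value theorem, combined
  with the uniform bound for the derivative of order \<open>Suc j\<close>. The constant is a
  negative power of the gauge, so closeness of higher order absorbs it. Both well-definedness and
  continuity of the derivatives rest on this.\<close>

lemma defining_net_Lipschitz:
  assumes g: "net_gauge \<rho>" and F: "defining_net \<rho> U f F" and "openin (sharp_topology \<rho>) U"
    and a: "moderate \<rho> a" "gclass \<rho> a \<in> U"
  obtains q N :: nat where "\<forall>\<^sub>F \<epsilon> in at_right 0. \<forall>t. \<bar>t - a \<epsilon>\<bar> \<le> \<rho> \<epsilon> ^ q \<longrightarrow>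
    \<bar>(deriv ^^ j) (F \<epsilon>) t - (deriv ^^ j) (F \<epsilon>) (a \<epsilon>)\<bar> \<le> inverse (\<rho> \<epsilon> ^ N) * \<bar>t - a \<epsilon>\<bar>"
proof -
  obtain q where "\<And>x. \<forall>\<^sub>F \<epsilon> in at_right 0. \<bar>x \<epsilon> - a \<epsilon>\<bar> \<le> \<rho> \<epsilon> ^ q \<Longrightarrow> gclass \<rho> x \<in> U"
    using openin_sharp_topologyD[OF g assms(3) a(2,1)] by blast
  from defining_net_bound[OF g F a(1) this, where j = "Suc j"]
  obtain N where N: "\<forall>\<^sub>F \<epsilon> in at_right 0. \<forall>t. \<bar>t - a \<epsilon>\<bar> \<le> \<rho> \<epsilon> ^ q \<longrightarrow>
      \<bar>(deriv ^^ Suc j) (F \<epsilon>) t\<bar> \<le> inverse (\<rho> \<epsilon> ^ N)"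
    by blast
  note unit = eventually_unit_interval
  from unit N have "\<forall>\<^sub>F \<epsilon> in at_right 0. \<forall>t. \<bar>t - a \<epsilon>\<bar> \<le> \<rho> \<epsilon> ^ q \<longrightarrow>
    \<bar>(deriv ^^ j) (F \<epsilon>) t - (deriv ^^ j) (F \<epsilon>) (a \<epsilon>)\<bar> \<le> inverse (\<rho> \<epsilon> ^ N) * \<bar>t - a \<epsilon>\<bar>"
  proof (eventually_elim, intro allI impI)
    fix \<epsilon> t
    assume \<epsilon>: "\<epsilon> \<in> {0<..1}" and t: "\<bar>t - a \<epsilon>\<bar> \<le> \<rho> \<epsilon> ^ q"
      and bd: "\<forall>t. \<bar>t - a \<epsilon>\<bar> \<le> \<rho> \<epsilon> ^ q \<longrightarrow> \<bar>(deriv ^^ Suc j) (F \<epsilon>) t\<bar> \<le> inverse (\<rho> \<epsilon> ^ N)"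
    have "smooth_fun (F \<epsilon>)" using F \<epsilon> unfolding defining_net_def by blast
    then obtain s where s: "\<bar>s - a \<epsilon>\<bar> \<le> \<bar>t - a \<epsilon>\<bar>"
      "(deriv ^^ j) (F \<epsilon>) t = (deriv ^^ j) (F \<epsilon>) (a \<epsilon>) + (deriv ^^ Suc j) (F \<epsilon>) s * (t - a \<epsilon>)"
      using smooth_fun_taylor[of "F \<epsilon>" "a \<epsilon>" t j 1] by auto
    then have "\<bar>(deriv ^^ Suc j) (F \<epsilon>) s\<bar> \<le> inverse (\<rho> \<epsilon> ^ N)" using bd t by force
    then show "\<bar>(deriv ^^ j) (F \<epsilon>) t - (deriv ^^ j) (F \<epsilon>) (a \<epsilon>)\<bar> \<le> inverse (\<rho> \<epsilon> ^ N) * \<bar>t - a \<epsilon>\<bar>"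
      unfolding s(2) by (simp add: abs_mult mult_right_mono)
  qed
  then show thesis by (rule that)
qed

text \<open>Equivalent representatives are eventually within
  \<open>\<rho> \<epsilon> ^ (N + n)\<close> of each other, which absorbs the Lipschitz constant, so
  the union in \<open>gs_deriv\<close> is a single class. The equation \<open>F_def\<close> pins
  \<open>F\<close> to the net chosen there; one \<open>F\<close> then serves all orders
  \<open>j\<close>.\<close>

lemma gs_deriv_gclass:
  assumes g: "net_gauge \<rho>" and U: "openin (sharp_topology \<rho>) U"
    and f: "gen_smooth \<rho> U f" and F_def: "F = (SOME F. defining_net \<rho> U f F)"
    and a: "moderate \<rho> a" "gclass \<rho> a \<in> U"
  shows "gs_deriv \<rho> U f j (gclass \<rho> a) = gclass \<rho> (\<lambda>\<epsilon>. (deriv ^^ j) (F \<epsilon>) (a \<epsilon>))"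
  unfolding gs_deriv_def Let_def F_def[symmetric]
proof (rule UN_gclass_const[OF g])
  have F: "defining_net \<rho> U f F"
    using f unfolding F_def gen_smooth_def by (simp add: someI_ex)
  fix y assume y: "net_equiv \<rho> y a"
  obtain q N where qN: "\<forall>\<^sub>F \<epsilon> in at_right 0. \<forall>t. \<bar>t - a \<epsilon>\<bar> \<le> \<rho> \<epsilon> ^ q \<longrightarrow>
    \<bar>(deriv ^^ j) (F \<epsilon>) t - (deriv ^^ j) (F \<epsilon>) (a \<epsilon>)\<bar> \<le> inverse (\<rho> \<epsilon> ^ N) * \<bar>t - a \<epsilon>\<bar>"
    by (rule defining_net_Lipschitz[OF g F U a])
  show "net_equiv \<rho> (\<lambda>\<epsilon>. (deriv ^^ j) (F \<epsilon>) (y \<epsilon>)) (\<lambda>\<epsilon>. (deriv ^^ j) (F \<epsilon>) (a \<epsilon>))"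
    unfolding net_equiv_def
  proof
    fix n :: nat
    have "\<forall>\<^sub>F \<epsilon> in at_right 0. \<bar>y \<epsilon> - a \<epsilon>\<bar> \<le> \<rho> \<epsilon> ^ q" "\<forall>\<^sub>F \<epsilon> in at_right 0. \<bar>y \<epsilon> - a \<epsilon>\<bar> \<le> \<rho> \<epsilon> ^ (N + n)"
      using y unfolding net_equiv_def by blast+
    with qN net_gaugeD[OF g]
    show "\<forall>\<^sub>F \<epsilon> in at_right 0. \<bar>(deriv ^^ j) (F \<epsilon>) (y \<epsilon>) - (deriv ^^ j) (F \<epsilon>) (a \<epsilon>)\<bar> \<le> \<rho> \<epsilon> ^ n"
    proof eventually_elim
      case (elim \<epsilon>)
      have "\<bar>(deriv ^^ j) (F \<epsilon>) (y \<epsilon>) - (deriv ^^ j) (F \<epsilon>) (a \<epsilon>)\<bar> \<le> inverse (\<rho> \<epsilon> ^ N) * \<bar>y \<epsilon> - a \<epsilon>\<bar>"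
        using elim by blast
      also have "\<dots> \<le> inverse (\<rho> \<epsilon> ^ N) * \<rho> \<epsilon> ^ (N + n)"
        using elim by (intro mult_left_mono) auto
      also have "\<dots> = \<rho> \<epsilon> ^ n" using elim by (simp add: power_add)
      finally show ?case .
    qed
  qed
qed

section \<open>The filter of tails of the hypernaturals\<close>

lemma zero_in_hypernat:
  assumes "net_gauge \<sigma>"
  shows "gclass \<sigma> (\<lambda>_. 0) \<in> hypernat \<sigma>"
  using moderate_const[OF assms, of 0] unfolding hypernat_def
  by (intro CollectI exI[of _ "\<lambda>_. 0"]) simp

text \<open>The sum of two nets of naturals lies above both, and the negligible error of the
  comparison with \<open>n\<close> can be kept.\<close>

lemma hypernat_directed:
  assumes s: "net_gauge \<sigma>" and "A \<in> hypernat \<sigma>" "B \<in> hypernat \<sigma>"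
  shows "\<exists>M\<in>hypernat \<sigma>. \<forall>n\<in>hypernat \<sigma>. gle \<sigma> M n \<longrightarrow> gle \<sigma> A n \<and> gle \<sigma> B n"
proof -
  obtain a b :: "real \<Rightarrow> nat" where a: "moderate \<sigma> (\<lambda>\<epsilon>. real (a \<epsilon>))" "A = gclass \<sigma> (\<lambda>\<epsilon>. real (a \<epsilon>))"
    and b: "moderate \<sigma> (\<lambda>\<epsilon>. real (b \<epsilon>))" "B = gclass \<sigma> (\<lambda>\<epsilon>. real (b \<epsilon>))"
    using assms by (auto simp: hypernat_def)
  let ?M = "gclass \<sigma> (\<lambda>\<epsilon>. real (a \<epsilon> + b \<epsilon>))"
  have "?M \<in> hypernat \<sigma>"
    using moderate_add[OF s a(1) b(1)] unfolding hypernat_def mem_Collect_eq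
    by (intro exI[of _ "\<lambda>\<epsilon>. a \<epsilon> + b \<epsilon>"]) simp
  moreover have "gle \<sigma> A n \<and> gle \<sigma> B n" if n: "n \<in> hypernat \<sigma>" and le: "gle \<sigma> ?M n" for n
  proof -
    obtain c :: "real \<Rightarrow> nat" where c: "n = gclass \<sigma> (\<lambda>\<epsilon>. real (c \<epsilon>))"
      using n unfolding hypernat_def by blast
    obtain z where "negligible_net \<sigma> z" "\<forall>\<^sub>F \<epsilon> in at_right 0. real (a \<epsilon> + b \<epsilon>) \<le> real (c \<epsilon>) + z \<epsilon>"
      using le unfolding c gle_gclass[OF s] by blast
    moreover from this(2) have "\<forall>\<^sub>F \<epsilon> in at_right 0. real (a \<epsilon>) \<le> real (c \<epsilon>) + z \<epsilon>"
      "\<forall>\<^sub>F \<epsilon> in at_right 0. real (b \<epsilon>) \<le> real (c \<epsilon>) + z \<epsilon>"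
      by (auto elim!: eventually_mono)
    ultimately show ?thesis unfolding c a(2) b(2) gle_gclass[OF s] by blast
  qed
  ultimately show ?thesis by blast
qed

text \<open>Phrasing hyperlimits by a filter lets tail conditions be combined as eventual
  statements. The tails are cut down to \<open>hypernat \<sigma>\<close> because \<open>gle\<close>
  compares arbitrary sets of nets.\<close>

definition hypernat_top :: "net \<Rightarrow> net set filter" where
  "hypernat_top \<sigma> = (INF M\<in>hypernat \<sigma>. principal {n \<in> hypernat \<sigma>. gle \<sigma> M n})"

text \<open>Directedness makes the tails a filter base, so a single \<open>M\<close> witnesses each
  eventual property.\<close>

lemma eventually_hypernat_top:
  assumes s: "net_gauge \<sigma>"
  shows "eventually P (hypernat_top \<sigma>) \<longleftrightarrow> (\<exists>M\<in>hypernat \<sigma>. \<forall>n\<in>hypernat \<sigma>. gle \<sigma> M n \<longrightarrow> P n)"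
proof -
  have "hypernat \<sigma> \<noteq> {}" using zero_in_hypernat[OF s] by blast
  moreover have "\<exists>M\<in>hypernat \<sigma>. principal {n \<in> hypernat \<sigma>. gle \<sigma> M n} \<le>
      inf (principal {n \<in> hypernat \<sigma>. gle \<sigma> A n}) (principal {n \<in> hypernat \<sigma>. gle \<sigma> B n})"
    if "A \<in> hypernat \<sigma>" "B \<in> hypernat \<sigma>" for A B
    using hypernat_directed[OF s that] by (auto simp: subset_iff)
  ultimately have "eventually P (hypernat_top \<sigma>) \<longleftrightarrow>
      (\<exists>M\<in>hypernat \<sigma>. eventually P (principal {n \<in> hypernat \<sigma>. gle \<sigma> M n}))"
    unfolding hypernat_top_def by (intro eventually_INF_base) auto
  then show ?thesis by (auto simp: eventually_principal)
qed

lemma eventually_hypernat_top_mem: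
  assumes "net_gauge \<sigma>"
  shows "\<forall>\<^sub>F n in hypernat_top \<sigma>. n \<in> hypernat \<sigma>"
  using zero_in_hypernat[OF assms] unfolding eventually_hypernat_top[OF assms] by auto

section \<open>Hyperlimits on the level of representatives\<close>

text \<open>The inner threshold for \<open>\<epsilon>\<close> may depend on \<open>n\<close>, since
  inequalities of classes hold only for small \<open>\<epsilon>\<close>. The inequality is weak:
  passing to the strict order of classes costs one exponent.\<close>

definition net_hyperlim :: "net \<Rightarrow> net \<Rightarrow> (net set \<Rightarrow> net) \<Rightarrow> net \<Rightarrow> bool" where
  "net_hyperlim \<sigma> \<rho> u a \<longleftrightarrow>
    (\<forall>q::nat. \<forall>\<^sub>F n in hypernat_top \<sigma>. \<forall>\<^sub>F \<epsilon> in at_right 0. \<bar>u n \<epsilon> - a \<epsilon>\<bar> \<le> \<rho> \<epsilon> ^ q)"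

lemma net_hyperlimD:
  "net_hyperlim \<sigma> \<rho> u a \<Longrightarrow>
    \<forall>\<^sub>F n in hypernat_top \<sigma>. \<forall>\<^sub>F \<epsilon> in at_right 0. \<bar>u n \<epsilon> - a \<epsilon>\<bar> \<le> \<rho> \<epsilon> ^ q"
  by (simp add: net_hyperlim_def)

text \<open>The exponent 0 puts \<open>u n\<close> within distance 1 of the moderate net
  \<open>a\<close>.\<close>

lemma net_hyperlim_moderate:
  assumes g: "net_gauge \<rho>" and "moderate \<rho> a" and "net_hyperlim \<sigma> \<rho> u a"
  shows "\<forall>\<^sub>F n in hypernat_top \<sigma>. moderate \<rho> (u n)"
  using net_hyperlimD[OF assms(3), of 0]
proof eventually_elim
  case (elim n)
  have "moderate \<rho> (\<lambda>\<epsilon>. u n \<epsilon> - a \<epsilon>)"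
    by (rule moderateI_le[OF g moderate_const[OF g, of 1]]) (use elim in eventually_elim, auto)
  from moderate_add[OF g this assms(2)] show ?case by simp
qed

text \<open>Agreement with \<open>u\<close> is required on a tail, since quotients may be undefined
  elsewhere. There the class of \<open>u n\<close> lies in the carrier, hence \<open>u n\<close> is
  moderate, and the gap hidden in the strict inequality is dropped.\<close>

lemma has_hyperlim_gclassD:
  assumes g: "net_gauge \<rho>" and s: "net_gauge \<sigma>" and a: "moderate \<rho> a"
    and lim: "has_hyperlim \<sigma> \<rho> x (gclass \<rho> a)"
    and u: "\<forall>\<^sub>F n in hypernat_top \<sigma>. x n = gclass \<rho> (u n)"
  shows "net_hyperlim \<sigma> \<rho> u a"
  unfolding net_hyperlim_def
proof
  fix q :: nat
  have "\<forall>\<^sub>F n in hypernat_top \<sigma>. x n \<in> carrier (gring \<rho>) \<and>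
      glt \<rho> (gabs \<rho> (x n \<ominus>\<^bsub>gring \<rho>\<^esub> gclass \<rho> a)) (gclass \<rho> \<rho> [^]\<^bsub>gring \<rho>\<^esub> q)"
    using lim unfolding has_hyperlim_def eventually_hypernat_top[OF s] by blast
  with u show "\<forall>\<^sub>F n in hypernat_top \<sigma>. \<forall>\<^sub>F \<epsilon> in at_right 0. \<bar>u n \<epsilon> - a \<epsilon>\<bar> \<le> \<rho> \<epsilon> ^ q"
  proof eventually_elim
    case (elim n)
    then have un: "moderate \<rho> (u n)" by (simp add: gclass_in_carrier_iff[OF g])
    have "glt \<rho> (gclass \<rho> (\<lambda>\<epsilon>. \<bar>u n \<epsilon> - a \<epsilon>\<bar>)) (gclass \<rho> (\<lambda>\<epsilon>. \<rho> \<epsilon> ^ q))"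
      using elim by (simp add: gring_ops(3)[OF g un a] gabs_gclass[OF g] gring_pow[OF g moderate_gauge[OF g]])
    then obtain p where "\<forall>\<^sub>F \<epsilon> in at_right 0. \<bar>u n \<epsilon> - a \<epsilon>\<bar> + \<rho> \<epsilon> ^ p \<le> \<rho> \<epsilon> ^ q"
      using glt_gclass_iff[OF g, of "\<lambda>\<epsilon>. \<bar>u n \<epsilon> - a \<epsilon>\<bar>" "\<lambda>\<epsilon>. \<rho> \<epsilon> ^ q"]
        moderate_diff[OF g un a] moderate_power[OF g moderate_gauge[OF g]] by (auto simp: moderate_abs)
    with net_gaugeD[OF g] show ?case
    proof eventually_elim
      case (elim \<epsilon>)
      have "0 < \<rho> \<epsilon> ^ p" using elim by simp
      with elim show ?case by linarith
    qed
  qed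
qed

lemma has_hyperlim_gclassI:
  assumes g: "net_gauge \<rho>" and s: "net_gauge \<sigma>" and a: "moderate \<rho> a"
    and lim: "net_hyperlim \<sigma> \<rho> u a"
    and u: "\<forall>\<^sub>F n in hypernat_top \<sigma>. x n = gclass \<rho> (u n)"
  shows "has_hyperlim \<sigma> \<rho> x (gclass \<rho> a)"
proof -
  have "\<forall>\<^sub>F n in hypernat_top \<sigma>. x n \<in> carrier (gring \<rho>) \<and>
      glt \<rho> (gabs \<rho> (x n \<ominus>\<^bsub>gring \<rho>\<^esub> gclass \<rho> a)) (gclass \<rho> \<rho> [^]\<^bsub>gring \<rho>\<^esub> q)" for q :: nat
    \<comment> \<open>The extra exponent creates the gap for the strict inequality: two copies of
      \<open>\<rho> \<epsilon> ^ Suc q\<close> fit into \<open>\<rho> \<epsilon> ^ q\<close> once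
      \<open>\<rho> \<epsilon> \<le> 1/2\<close>.\<close>
    using u net_hyperlimD[OF lim, of "Suc q"] net_hyperlim_moderate[OF g a lim]
  proof eventually_elim
    case (elim n)
    then have un: "moderate \<rho> (u n)" by simp
    have "\<forall>\<^sub>F \<epsilon> in at_right 0. \<bar>u n \<epsilon> - a \<epsilon>\<bar> + \<rho> \<epsilon> ^ Suc q \<le> \<rho> \<epsilon> ^ q"
      using elim(2) net_gaugeD[OF g] net_gauge_small[OF g, of "1/2", simplified]
    proof eventually_elim
      case (elim \<epsilon>)
      have "\<rho> \<epsilon> * \<rho> \<epsilon> ^ q \<le> 1/2 * \<rho> \<epsilon> ^ q" using elim by (intro mult_right_mono) auto
      then show ?case using elim(1) unfolding power_Suc by linarith
    qed
    then have "glt \<rho> (gclass \<rho> (\<lambda>\<epsilon>. \<bar>u n \<epsilon> - a \<epsilon>\<bar>)) (gclass \<rho> (\<lambda>\<epsilon>. \<rho> \<epsilon> ^ q))"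
      using glt_gclass_iff[OF g, of "\<lambda>\<epsilon>. \<bar>u n \<epsilon> - a \<epsilon>\<bar>" "\<lambda>\<epsilon>. \<rho> \<epsilon> ^ q"]
        moderate_diff[OF g un a] moderate_power[OF g moderate_gauge[OF g]]
      by (auto simp: moderate_abs simp del: power_Suc)
    then show ?case
      using elim by (simp add: gring_ops(3)[OF g un a] gabs_gclass[OF g]
          gring_pow[OF g moderate_gauge[OF g]] gclass_in_carrier_iff[OF g])
  qed
  then show ?thesis
    unfolding has_hyperlim_def eventually_hypernat_top[OF s] by (simp add: gclass_in_carrier_iff[OF g] a)
qed

lemma net_hyperlim_mult:
  assumes g: "net_gauge \<rho>" and a: "moderate \<rho> a" and b: "moderate \<rho> b"
    and u: "net_hyperlim \<sigma> \<rho> u a" and v: "net_hyperlim \<sigma> \<rho> v b"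
  shows "net_hyperlim \<sigma> \<rho> (\<lambda>n \<epsilon>. u n \<epsilon> * v n \<epsilon>) (\<lambda>\<epsilon>. a \<epsilon> * b \<epsilon>)"
  unfolding net_hyperlim_def
proof
  fix q :: nat
  \<comment> \<open>The term \<open>|a| + 1\<close> bounds \<open>u n\<close> once it is within 1 of
    \<open>a\<close>, and \<open>|b|\<close> is the coefficient of the other error. Their sum is at
    most \<open>\<rho>^-N\<close>, so closeness of order \<open>N + q\<close> in both factors gives
    order \<open>q\<close> for the product.\<close>
  have "moderate \<rho> (\<lambda>\<epsilon>. (\<bar>a \<epsilon>\<bar> + 1) + \<bar>b \<epsilon>\<bar>)"
    by (intro moderate_add g moderate_const moderate_abs[THEN iffD2] a b)
  then obtain N where N: "\<forall>\<^sub>F \<epsilon> in at_right 0. \<bar>(\<bar>a \<epsilon>\<bar> + 1) + \<bar>b \<epsilon>\<bar>\<bar> \<le> inverse (\<rho> \<epsilon> ^ N)"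
    unfolding moderate_def by blast
  show "\<forall>\<^sub>F n in hypernat_top \<sigma>. \<forall>\<^sub>F \<epsilon> in at_right 0. \<bar>u n \<epsilon> * v n \<epsilon> - a \<epsilon> * b \<epsilon>\<bar> \<le> \<rho> \<epsilon> ^ q"
    using net_hyperlimD[OF u, of "N + q"] net_hyperlimD[OF v, of "N + q"]
  proof eventually_elim
    case (elim n)
    then show ?case using N net_gaugeD[OF g]
    proof eventually_elim
      case (elim \<epsilon>)
      have le1: "\<rho> \<epsilon> ^ (N + q) \<le> 1" using elim by (intro power_le_one) auto
      then have "\<bar>u n \<epsilon>\<bar> \<le> \<bar>a \<epsilon>\<bar> + 1" using elim by linarith
      then have "\<bar>u n \<epsilon>\<bar> * \<bar>v n \<epsilon> - b \<epsilon>\<bar> \<le> (\<bar>a \<epsilon>\<bar> + 1) * \<rho> \<epsilon> ^ (N + q)"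
        using elim by (intro mult_mono) auto
      moreover have "\<bar>b \<epsilon>\<bar> * \<bar>u n \<epsilon> - a \<epsilon>\<bar> \<le> \<bar>b \<epsilon>\<bar> * \<rho> \<epsilon> ^ (N + q)"
        using elim by (intro mult_left_mono) auto
      moreover have "u n \<epsilon> * v n \<epsilon> - a \<epsilon> * b \<epsilon> = u n \<epsilon> * (v n \<epsilon> - b \<epsilon>) + b \<epsilon> * (u n \<epsilon> - a \<epsilon>)"
        by (simp add: algebra_simps)
      ultimately have "\<bar>u n \<epsilon> * v n \<epsilon> - a \<epsilon> * b \<epsilon>\<bar> \<le> ((\<bar>a \<epsilon>\<bar> + 1) + \<bar>b \<epsilon>\<bar>) * \<rho> \<epsilon> ^ (N + q)"
        using abs_triangle_ineq[of "u n \<epsilon> * (v n \<epsilon> - b \<epsilon>)" "b \<epsilon> * (u n \<epsilon> - a \<epsilon>)"]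
        by (simp add: abs_mult distrib_right)
      also have "\<dots> \<le> inverse (\<rho> \<epsilon> ^ N) * \<rho> \<epsilon> ^ (N + q)"
        using elim by (intro mult_right_mono) auto
      also have "\<dots> = \<rho> \<epsilon> ^ q" using elim by (simp add: power_add)
      finally show ?case .
    qed
  qed
qed

lemma net_hyperlim_power:
  assumes g: "net_gauge \<rho>" and a: "moderate \<rho> a" and u: "net_hyperlim \<sigma> \<rho> u a"
  shows "net_hyperlim \<sigma> \<rho> (\<lambda>n \<epsilon>. u n \<epsilon> ^ p) (\<lambda>\<epsilon>. a \<epsilon> ^ p)"
proof (induction p)
  case 0
  have "\<forall>\<^sub>F \<epsilon> in at_right 0. 0 \<le> \<rho> \<epsilon> ^ q" for q
    using net_gaugeD[OF g] by eventually_elim simp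
  then show ?case by (simp add: net_hyperlim_def)
next
  case (Suc p)
  show ?case using net_hyperlim_mult[OF g a moderate_power[OF g a] u Suc] by simp
qed

text \<open>Closeness of order \<open>Suc p\<close> takes away at most half of
  \<open>\<rho> ^ p\<close>. The new exponent is the same on a whole tail, as the estimate of
  reciprocals requires.\<close>

lemma net_hyperlim_bounded_away:
  assumes g: "net_gauge \<rho>" and p: "\<forall>\<^sub>F \<epsilon> in at_right 0. \<rho> \<epsilon> ^ p \<le> \<bar>a \<epsilon>\<bar>"
    and u: "net_hyperlim \<sigma> \<rho> u a"
  shows "\<forall>\<^sub>F n in hypernat_top \<sigma>. \<forall>\<^sub>F \<epsilon> in at_right 0. \<rho> \<epsilon> ^ Suc p \<le> \<bar>u n \<epsilon>\<bar>"
  using net_hyperlimD[OF u, of "Suc p"]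
proof eventually_elim
  case (elim n)
  then show ?case
    using p net_gaugeD[OF g] net_gauge_small[OF g, of "1/2", simplified]
  proof eventually_elim
    case (elim \<epsilon>)
    have "\<rho> \<epsilon> * \<rho> \<epsilon> ^ p \<le> 1/2 * \<rho> \<epsilon> ^ p" using elim by (intro mult_right_mono) auto
    then show ?case using elim(1,2) unfolding power_Suc by linarith
  qed
qed

lemma net_hyperlim_inverse:
  assumes g: "net_gauge \<rho>" and a: "bounded_away \<rho> a" and u: "net_hyperlim \<sigma> \<rho> u a"
  shows "net_hyperlim \<sigma> \<rho> (\<lambda>n \<epsilon>. inverse (u n \<epsilon>)) (\<lambda>\<epsilon>. inverse (a \<epsilon>))"
  unfolding net_hyperlim_def
proof
  fix q :: nat
  obtain p where p: "\<forall>\<^sub>F \<epsilon> in at_right 0. \<rho> \<epsilon> ^ p \<le> \<bar>a \<epsilon>\<bar>"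
    using a unfolding bounded_away_def by blast
  show "\<forall>\<^sub>F n in hypernat_top \<sigma>. \<forall>\<^sub>F \<epsilon> in at_right 0. \<bar>inverse (u n \<epsilon>) - inverse (a \<epsilon>)\<bar> \<le> \<rho> \<epsilon> ^ q"
    \<comment> \<open>The difference of the reciprocals is \<open>|u - a| / (|u| |a|)\<close>; the
      exponents \<open>Suc p\<close> and \<open>p\<close> pay for the lower bounds of the two
      denominators and leave \<open>q\<close>.\<close>
    using net_hyperlimD[OF u, of "Suc p + p + q"] net_hyperlim_bounded_away[OF g p u]
  proof eventually_elim
    case (elim n)
    then show ?case using p net_gaugeD[OF g]
    proof eventually_elim
      case (elim \<epsilon>)
      have pos: "0 < \<rho> \<epsilon> ^ p" "0 < \<rho> \<epsilon> ^ Suc p" using elim by auto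
      have nz: "u n \<epsilon> \<noteq> 0" "a \<epsilon> \<noteq> 0"
        using less_le_trans[OF pos(2) elim(2)] less_le_trans[OF pos(1) elim(3)] by simp_all
      have "\<bar>inverse (u n \<epsilon>) - inverse (a \<epsilon>)\<bar> = \<bar>u n \<epsilon> - a \<epsilon>\<bar> / (\<bar>u n \<epsilon>\<bar> * \<bar>a \<epsilon>\<bar>)"
        using nz by (simp add: inverse_diff_inverse abs_mult divide_inverse abs_minus_commute)
      also have "\<dots> \<le> \<rho> \<epsilon> ^ (Suc p + p + q) / (\<rho> \<epsilon> ^ Suc p * \<rho> \<epsilon> ^ p)"
        using elim pos by (intro frac_le mult_mono mult_pos_pos) auto
      also have "\<dots> = \<rho> \<epsilon> ^ q"
        using pos elim by (simp add: power_add)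
      finally show ?case .
    qed
  qed
qed

section \<open>Derivatives and Taylor remainders along hyperlimits\<close>

text \<open>Closeness of order \<open>q\<close> places \<open>u n\<close> in the interval of the
  Lipschitz estimate, and order \<open>N + r\<close> absorbs its constant.\<close>

lemma net_hyperlim_deriv:
  assumes g: "net_gauge \<rho>" and F: "defining_net \<rho> U f F" and U: "openin (sharp_topology \<rho>) U"
    and a: "moderate \<rho> a" "gclass \<rho> a \<in> U"
    and u: "net_hyperlim \<sigma> \<rho> u a"
  shows "net_hyperlim \<sigma> \<rho> (\<lambda>n \<epsilon>. (deriv ^^ j) (F \<epsilon>) (u n \<epsilon>)) (\<lambda>\<epsilon>. (deriv ^^ j) (F \<epsilon>) (a \<epsilon>))"
  unfolding net_hyperlim_def
proof
  fix r :: nat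
  obtain q N where qN: "\<forall>\<^sub>F \<epsilon> in at_right 0. \<forall>t. \<bar>t - a \<epsilon>\<bar> \<le> \<rho> \<epsilon> ^ q \<longrightarrow>
    \<bar>(deriv ^^ j) (F \<epsilon>) t - (deriv ^^ j) (F \<epsilon>) (a \<epsilon>)\<bar> \<le> inverse (\<rho> \<epsilon> ^ N) * \<bar>t - a \<epsilon>\<bar>"
    by (rule defining_net_Lipschitz[OF g F U a])
  show "\<forall>\<^sub>F n in hypernat_top \<sigma>. \<forall>\<^sub>F \<epsilon> in at_right 0.
      \<bar>(deriv ^^ j) (F \<epsilon>) (u n \<epsilon>) - (deriv ^^ j) (F \<epsilon>) (a \<epsilon>)\<bar> \<le> \<rho> \<epsilon> ^ r"
    using net_hyperlimD[OF u, of q] net_hyperlimD[OF u, of "N + r"]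
  proof eventually_elim
    case (elim n)
    then show ?case using qN net_gaugeD[OF g]
    proof eventually_elim
      case (elim \<epsilon>)
      have "\<bar>(deriv ^^ j) (F \<epsilon>) (u n \<epsilon>) - (deriv ^^ j) (F \<epsilon>) (a \<epsilon>)\<bar> \<le> inverse (\<rho> \<epsilon> ^ N) * \<bar>u n \<epsilon> - a \<epsilon>\<bar>"
        using elim by blast
      also have "\<dots> \<le> inverse (\<rho> \<epsilon> ^ N) * \<rho> \<epsilon> ^ (N + r)"
        using elim by (intro mult_left_mono) auto
      also have "\<dots> = \<rho> \<epsilon> ^ r" using elim by (simp add: power_add)
      finally show ?case .
    qed
  qed
qed

text \<open>The factorials cancel. Where a denominator vanishes both sides agree by the convention
  that division by zero yields 0, so the two nets of quotients are equal as functions.\<close>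

lemma taylor_quotient:
  fixes w z s t :: real
  shows "w / fact p * s ^ p / (z / fact p * t ^ p) = (s / t) ^ p * (w * inverse z)"
  by (simp add: power_divide divide_simps)

text \<open>
  If the lower derivatives vanish at the limit point \<open>a\<close>, their contribution to the Taylor
  expansion is negligible; \<open>w n\<close> is the \<open>k\<close>-th derivative at the intermediate points of the
  Lagrange remainder.
\<close>

lemma gs_deriv_taylor:
  assumes g: "net_gauge \<rho>" and U: "openin (sharp_topology \<rho>) U" and f: "gen_smooth \<rho> U f"
    and F_def: "F = (SOME F. defining_net \<rho> U f F)"
    and a: "moderate \<rho> a" "gclass \<rho> a \<in> U"
    and zero: "\<forall>i<k. gs_deriv \<rho> U f i (gclass \<rho> a) = \<zero>\<^bsub>gring \<rho>\<^esub>"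
    and u: "net_hyperlim \<sigma> \<rho> u a"
    and j: "j \<le> k"
  shows "\<exists>w. net_hyperlim \<sigma> \<rho> w (\<lambda>\<epsilon>. (deriv ^^ k) (F \<epsilon>) (a \<epsilon>)) \<and>
    (\<forall>n. moderate \<rho> (u n) \<longrightarrow> gclass \<rho> (u n) \<in> U \<longrightarrow>
      gs_deriv \<rho> U f j (gclass \<rho> (u n)) =
      gclass \<rho> (\<lambda>\<epsilon>. w n \<epsilon> / fact (k - j) * (u n \<epsilon> - a \<epsilon>) ^ (k - j)))"
proof -
  have F: "defining_net \<rho> U f F"
    using f unfolding F_def gen_smooth_def by (simp add: someI_ex)
  note gs = gs_deriv_gclass[OF g U f F_def]
  let ?S = "\<lambda>n \<epsilon>. \<Sum>i<k - j. (deriv ^^ (j + i)) (F \<epsilon>) (a \<epsilon>) / fact i * (u n \<epsilon> - a \<epsilon>) ^ i"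
  \<comment> \<open>The Taylor identity is claimed only on \<open>(0,1]\<close>, where
    \<open>F \<epsilon>\<close> is smooth, whereas the distance bound is claimed for every
    \<open>\<epsilon>\<close>. Thus an intermediate point exists for all \<open>n\<close> and
    \<open>\<epsilon>\<close>.\<close>
  let ?P = "\<lambda>n \<epsilon> t. \<bar>t - a \<epsilon>\<bar> \<le> \<bar>u n \<epsilon> - a \<epsilon>\<bar> \<and> (\<epsilon> \<in> {0<..1} \<longrightarrow>
      (deriv ^^ j) (F \<epsilon>) (u n \<epsilon>) =
      ?S n \<epsilon> + (deriv ^^ k) (F \<epsilon>) t / fact (k - j) * (u n \<epsilon> - a \<epsilon>) ^ (k - j))"
  have ex: "\<exists>t. ?P n \<epsilon> t" for n \<epsilon>
  proof (cases "\<epsilon> \<in> {0<..1}")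
    case True
    then have "smooth_fun (F \<epsilon>)" using F unfolding defining_net_def by blast
    from smooth_fun_taylor[OF this, of "a \<epsilon>" "u n \<epsilon>" j "k - j"] show ?thesis
      unfolding le_add_diff_inverse[OF j] by blast
  qed auto
  define t where "t = (\<lambda>n \<epsilon>. SOME t. ?P n \<epsilon> t)"
  have P: "?P n \<epsilon> (t n \<epsilon>)" for n \<epsilon> unfolding t_def by (rule someI_ex[OF ex])
  have t: "\<bar>t n \<epsilon> - a \<epsilon>\<bar> \<le> \<bar>u n \<epsilon> - a \<epsilon>\<bar>" for n \<epsilon>
    by (rule conjunct1[OF P])
  \<comment> \<open>The intermediate points are at least as close to \<open>a\<close> as
    \<open>u n\<close>, so they inherit its hyperlimit.\<close>
  have "net_hyperlim \<sigma> \<rho> t a"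
    unfolding net_hyperlim_def
  proof
    fix q
    show "\<forall>\<^sub>F n in hypernat_top \<sigma>. \<forall>\<^sub>F \<epsilon> in at_right 0. \<bar>t n \<epsilon> - a \<epsilon>\<bar> \<le> \<rho> \<epsilon> ^ q"
      using net_hyperlimD[OF u, of q]
    proof eventually_elim
      case (elim n)
      then show ?case by eventually_elim (use t order_trans in blast)
    qed
  qed
  then have lim: "net_hyperlim \<sigma> \<rho> (\<lambda>n \<epsilon>. (deriv ^^ k) (F \<epsilon>) (t n \<epsilon>)) (\<lambda>\<epsilon>. (deriv ^^ k) (F \<epsilon>) (a \<epsilon>))"
    by (rule net_hyperlim_deriv[OF g F U a])
  have "gs_deriv \<rho> U f j (gclass \<rho> (u n)) =
      gclass \<rho> (\<lambda>\<epsilon>. (deriv ^^ k) (F \<epsilon>) (t n \<epsilon>) / fact (k - j) * (u n \<epsilon> - a \<epsilon>) ^ (k - j))"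
    if un: "moderate \<rho> (u n)" "gclass \<rho> (u n) \<in> U" for n
  proof -
    have S: "negligible_net \<rho> (?S n)"
    proof (rule negligible_sum[OF g])
      fix i assume "i \<in> {..<k - j}"
      then have "gclass \<rho> (\<lambda>\<epsilon>. (deriv ^^ (j + i)) (F \<epsilon>) (a \<epsilon>)) = gclass \<rho> (\<lambda>_. 0)"
        using zero[rule_format, of "j + i"] unfolding gs[OF a] gring_ops(4)[OF g a(1) a(1)] by simp
      then have "negligible_net \<rho> (\<lambda>\<epsilon>. (deriv ^^ (j + i)) (F \<epsilon>) (a \<epsilon>))"
        by (simp add: gclass_eq_iff[OF g] net_equiv_iff)
      moreover have "moderate \<rho> (\<lambda>\<epsilon>. inverse (fact i) * (u n \<epsilon> - a \<epsilon>) ^ i)"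
        by (intro moderate_mult moderate_const moderate_power moderate_diff g un a)
      ultimately have "negligible_net \<rho> (\<lambda>\<epsilon>. (deriv ^^ (j + i)) (F \<epsilon>) (a \<epsilon>) *
          (inverse (fact i) * (u n \<epsilon> - a \<epsilon>) ^ i))"
        by (rule negligible_mult[OF g])
      then show "negligible_net \<rho> (\<lambda>\<epsilon>. (deriv ^^ (j + i)) (F \<epsilon>) (a \<epsilon>) / fact i * (u n \<epsilon> - a \<epsilon>) ^ i)"
        by (simp add: divide_inverse mult.assoc)
    qed
    from eventually_unit_interval have "\<forall>\<^sub>F \<epsilon> in at_right 0. (deriv ^^ j) (F \<epsilon>) (u n \<epsilon>) =
      ?S n \<epsilon> + (deriv ^^ k) (F \<epsilon>) (t n \<epsilon>) / fact (k - j) * (u n \<epsilon> - a \<epsilon>) ^ (k - j)"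
      by eventually_elim (rule mp[OF conjunct2[OF P]])
    then have "gclass \<rho> (\<lambda>\<epsilon>. (deriv ^^ j) (F \<epsilon>) (u n \<epsilon>)) =
      gclass \<rho> (\<lambda>\<epsilon>. ?S n \<epsilon> + (deriv ^^ k) (F \<epsilon>) (t n \<epsilon>) / fact (k - j) * (u n \<epsilon> - a \<epsilon>) ^ (k - j))"
      by (rule gclass_eqI_eventually[OF g])
    also have "\<dots> = gclass \<rho> (\<lambda>\<epsilon>. (deriv ^^ k) (F \<epsilon>) (t n \<epsilon>) / fact (k - j) * (u n \<epsilon> - a \<epsilon>) ^ (k - j))"
      using S by (simp add: gclass_eq_iff[OF g] net_equiv_iff)
    finally show ?thesis unfolding gs[OF un] .
  qed
  with lim show ?thesis
    by (intro exI[of _ "\<lambda>n \<epsilon>. (deriv ^^ k) (F \<epsilon>) (t n \<epsilon>)"] conjI allI impI)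
qed

section \<open>Hyperlimits of the quotients of derivatives\<close>

theorem theorem44:
  fixes \<rho> \<sigma> :: net and U :: "net set set"
    and x y f g :: "net set \<Rightarrow> net set"
    and l m C :: "net set" and k :: nat
  assumes "net_gauge \<rho>" and "net_gauge \<sigma>"
    and "openin (sharp_topology \<rho>) U"
    and "x \<in> hypernat \<sigma> \<rightarrow> U" and "y \<in> hypernat \<sigma> \<rightarrow> U"
    and "l \<in> U" and "m \<in> U"
    and "has_hyperlim \<sigma> \<rho> x l" and "has_hyperlim \<sigma> \<rho> y m"
    and "has_hyperlim \<sigma> \<rho> (\<lambda>n. gdiv \<rho> (x n \<ominus>\<^bsub>gring \<rho>\<^esub> l) (y n \<ominus>\<^bsub>gring \<rho>\<^esub> m)) C"
    and "k > 0"
    and "gen_smooth \<rho> U f" and "gen_smooth \<rho> U g"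
    and "\<And>n j. n \<in> hypernat \<sigma> \<Longrightarrow> j < k \<Longrightarrow> gs_deriv \<rho> U g j (y n) \<in> Units (gring \<rho>)"
    and "\<And>j. j < k \<Longrightarrow> gs_deriv \<rho> U f j l = \<zero>\<^bsub>gring \<rho>\<^esub>"
    and "\<And>j. j < k \<Longrightarrow> gs_deriv \<rho> U g j m = \<zero>\<^bsub>gring \<rho>\<^esub>"
    and "gs_deriv \<rho> U g k m \<in> Units (gring \<rho>)"
  shows "\<exists>L. has_hyperlim \<sigma> \<rho> (\<lambda>n. gdiv \<rho> (gs_deriv \<rho> U f k (x n)) (gs_deriv \<rho> U g k (y n))) L \<and>
    (\<forall>j<k. has_hyperlim \<sigma> \<rho> (\<lambda>n. gdiv \<rho> (gs_deriv \<rho> U f j (x n)) (gs_deriv \<rho> U g j (y n)))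
             (C [^]\<^bsub>gring \<rho>\<^esub> (k - j) \<otimes>\<^bsub>gring \<rho>\<^esub> L))"

proof -
  note g = assms(1) and s = assms(2) and U = assms(3)
  define F where "F = (SOME F. defining_net \<rho> U f F)"
  define G where "G = (SOME G. defining_net \<rho> U g G)"
  have F: "defining_net \<rho> U f F" and G: "defining_net \<rho> U g G"
    using assms(12,13) unfolding F_def G_def gen_smooth_def by (simp_all add: someI_ex)
  have U_carrier: "U \<subseteq> carrier (gring \<rho>)" using assms(12) by (simp add: gen_smooth_def)
  obtain a where a: "moderate \<rho> a" "l = gclass \<rho> a"
    using assms(6) U_carrier by (blast elim: gring_carrierE)
  obtain b where b: "moderate \<rho> b" "m = gclass \<rho> b"
    using assms(7) U_carrier by (blast elim: gring_carrierE)
  obtain c where c: "moderate \<rho> c" "C = gclass \<rho> c"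
    using assms(10)[unfolded has_hyperlim_def, THEN conjunct1] by (rule gring_carrierE)
  have rep: "\<forall>n\<in>hypernat \<sigma>. \<exists>w. moderate \<rho> w \<and> z n = gclass \<rho> w"
    if z: "z \<in> hypernat \<sigma> \<rightarrow> U" for z
  proof
    fix n assume "n \<in> hypernat \<sigma>"
    with z have "z n \<in> U" by (rule funcset_mem)
    with U_carrier have "z n \<in> carrier (gring \<rho>)" by (rule subsetD)
    then obtain w where "moderate \<rho> w" "z n = gclass \<rho> w" by (rule gring_carrierE)
    then show "\<exists>w. moderate \<rho> w \<and> z n = gclass \<rho> w" by (intro exI conjI)
  qed
  from bchoice[OF rep[OF assms(4)]] obtain u
    where u_all: "\<forall>n\<in>hypernat \<sigma>. moderate \<rho> (u n) \<and> x n = gclass \<rho> (u n)" ..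
  from bchoice[OF rep[OF assms(5)]] obtain v
    where v_all: "\<forall>n\<in>hypernat \<sigma>. moderate \<rho> (v n) \<and> y n = gclass \<rho> (v n)" ..
  note u = bspec[OF u_all] and v = bspec[OF v_all]
  note mem = eventually_hypernat_top_mem[OF s]
  have u_lim: "net_hyperlim \<sigma> \<rho> u a"
    by (rule has_hyperlim_gclassD[OF g s a(1) assms(8)[unfolded a(2)]])
      (use mem in eventually_elim, simp add: u)
  have v_lim: "net_hyperlim \<sigma> \<rho> v b"
    by (rule has_hyperlim_gclassD[OF g s b(1) assms(9)[unfolded b(2)]])
      (use mem in eventually_elim, simp add: v)
  have c_lim: "net_hyperlim \<sigma> \<rho> (\<lambda>n \<epsilon>. (u n \<epsilon> - a \<epsilon>) / (v n \<epsilon> - b \<epsilon>)) c"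
  proof (rule has_hyperlim_gclassD[OF g s c(1) assms(10)[unfolded c(2)]])
    \<comment> \<open>The existence of \<open>C\<close> includes that the quotient is defined on a
      tail. An undefined quotient is the empty set, which is not in the carrier, so the difference
      of \<open>y n\<close> and \<open>m\<close> is invertible there.\<close>
    have "\<forall>\<^sub>F n in hypernat_top \<sigma>. gdiv \<rho> (x n \<ominus>\<^bsub>gring \<rho>\<^esub> l) (y n \<ominus>\<^bsub>gring \<rho>\<^esub> m) \<in> carrier (gring \<rho>)"
      using assms(10) unfolding has_hyperlim_def eventually_hypernat_top[OF s] by blast
    with mem show "\<forall>\<^sub>F n in hypernat_top \<sigma>. gdiv \<rho> (x n \<ominus>\<^bsub>gring \<rho>\<^esub> l) (y n \<ominus>\<^bsub>gring \<rho>\<^esub> m) =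
        gclass \<rho> (\<lambda>\<epsilon>. (u n \<epsilon> - a \<epsilon>) / (v n \<epsilon> - b \<epsilon>))"
    proof eventually_elim
      case (elim n)
      have mod: "moderate \<rho> (\<lambda>\<epsilon>. u n \<epsilon> - a \<epsilon>)" "moderate \<rho> (\<lambda>\<epsilon>. v n \<epsilon> - b \<epsilon>)"
        using u v a b elim by (auto intro: moderate_diff[OF g])
      have eq: "x n \<ominus>\<^bsub>gring \<rho>\<^esub> l = gclass \<rho> (\<lambda>\<epsilon>. u n \<epsilon> - a \<epsilon>)"
        "y n \<ominus>\<^bsub>gring \<rho>\<^esub> m = gclass \<rho> (\<lambda>\<epsilon>. v n \<epsilon> - b \<epsilon>)"
        using u v a b elim by (simp_all add: gring_ops(3)[OF g])
      have "gclass \<rho> (\<lambda>\<epsilon>. v n \<epsilon> - b \<epsilon>) \<in> Units (gring \<rho>)"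
        using elim(2) empty_notin_gring[OF g] unfolding eq gdiv_def by (auto split: if_splits)
      then show ?case
        unfolding eq using gdiv_gclass[OF g mod] gclass_Units_iff[OF g mod(2)] by simp
    qed
  qed
  let ?Fk = "\<lambda>\<epsilon>. (deriv ^^ k) (F \<epsilon>) (a \<epsilon>)" and ?Gk = "\<lambda>\<epsilon>. (deriv ^^ k) (G \<epsilon>) (b \<epsilon>)"
  have Fk: "moderate \<rho> ?Fk" using F a assms(6) unfolding defining_net_def by blast
  have Gk: "moderate \<rho> ?Gk" using G b assms(7) unfolding defining_net_def by blast
  have "gclass \<rho> ?Gk \<in> Units (gring \<rho>)"
    using assms(7,17) gs_deriv_gclass[OF g U assms(13) G_def b(1)] by (simp add: b(2))
  then have Gk_away: "bounded_away \<rho> ?Gk" using gclass_Units_iff[OF g Gk] by simp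
  \<comment> \<open>A representative of \<open>f^(k)(l) / g^(k)(m)\<close>, the value that
    continuity of the derivatives of order \<open>k\<close> dictates for the limit.\<close>
  let ?L = "\<lambda>\<epsilon>. ?Fk \<epsilon> * inverse (?Gk \<epsilon>)"
  have L: "moderate \<rho> ?L"
    by (rule moderate_mult[OF g Fk bounded_away_inverse[OF g Gk_away]])
  \<comment> \<open>The case \<open>j = k\<close> is included: there the power of \<open>C\<close>
    is 1 and the claim provides the hyperlimit on the right-hand side. In general a remainder of
    order \<open>k - j\<close> yields \<open>k - j\<close> factors
    \<open>(x n - l) / (y n - m)\<close>, hence that power of \<open>C\<close>.\<close>
  have main: "has_hyperlim \<sigma> \<rho> (\<lambda>n. gdiv \<rho> (gs_deriv \<rho> U f j (x n)) (gs_deriv \<rho> U g j (y n)))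
      (C [^]\<^bsub>gring \<rho>\<^esub> (k - j) \<otimes>\<^bsub>gring \<rho>\<^esub> gclass \<rho> ?L)" if j: "j \<le> k" for j
  proof -
    have aU: "gclass \<rho> a \<in> U" and bU: "gclass \<rho> b \<in> U" using assms(6,7) a b by simp_all
    have f0: "\<forall>i<k. gs_deriv \<rho> U f i (gclass \<rho> a) = \<zero>\<^bsub>gring \<rho>\<^esub>"
      and g0: "\<forall>i<k. gs_deriv \<rho> U g i (gclass \<rho> b) = \<zero>\<^bsub>gring \<rho>\<^esub>"
      using assms(15,16) unfolding a(2) b(2) by simp_all
    obtain w where w: "net_hyperlim \<sigma> \<rho> w ?Fk"
      "\<forall>n. moderate \<rho> (u n) \<longrightarrow> gclass \<rho> (u n) \<in> U \<longrightarrow> gs_deriv \<rho> U f j (gclass \<rho> (u n)) =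
        gclass \<rho> (\<lambda>\<epsilon>. w n \<epsilon> / fact (k - j) * (u n \<epsilon> - a \<epsilon>) ^ (k - j))"
      using gs_deriv_taylor[OF g U assms(12) F_def a(1) aU f0 u_lim j]
      by (elim exE conjE)
    obtain z where z: "net_hyperlim \<sigma> \<rho> z ?Gk"
      "\<forall>n. moderate \<rho> (v n) \<longrightarrow> gclass \<rho> (v n) \<in> U \<longrightarrow> gs_deriv \<rho> U g j (gclass \<rho> (v n)) =
        gclass \<rho> (\<lambda>\<epsilon>. z n \<epsilon> / fact (k - j) * (v n \<epsilon> - b \<epsilon>) ^ (k - j))"
      using gs_deriv_taylor[OF g U assms(13) G_def b(1) bU g0 v_lim j]
      by (elim exE conjE)
    let ?A = "\<lambda>n \<epsilon>. w n \<epsilon> / fact (k - j) * (u n \<epsilon> - a \<epsilon>) ^ (k - j)"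
    let ?B = "\<lambda>n \<epsilon>. z n \<epsilon> / fact (k - j) * (v n \<epsilon> - b \<epsilon>) ^ (k - j)"
    \<comment> \<open>The quotient of \<open>?A\<close> and \<open>?B\<close>, regrouped into
      factors whose hyperlimits are known.\<close>
    let ?Q = "\<lambda>n \<epsilon>. ((u n \<epsilon> - a \<epsilon>) / (v n \<epsilon> - b \<epsilon>)) ^ (k - j) * (w n \<epsilon> * inverse (z n \<epsilon>))"
    obtain p where "\<forall>\<^sub>F \<epsilon> in at_right 0. \<rho> \<epsilon> ^ p \<le> \<bar>?Gk \<epsilon>\<bar>"
      using Gk_away unfolding bounded_away_def by blast
    from net_hyperlim_bounded_away[OF g this z(1)]
    have z_away: "\<forall>\<^sub>F n in hypernat_top \<sigma>. bounded_away \<rho> (z n)"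
      unfolding bounded_away_def by eventually_elim (rule exI)
    have "has_hyperlim \<sigma> \<rho> (\<lambda>n. gdiv \<rho> (gs_deriv \<rho> U f j (x n)) (gs_deriv \<rho> U g j (y n)))
        (gclass \<rho> (\<lambda>\<epsilon>. c \<epsilon> ^ (k - j) * ?L \<epsilon>))"
    proof (rule has_hyperlim_gclassI[OF g s])
      show "moderate \<rho> (\<lambda>\<epsilon>. c \<epsilon> ^ (k - j) * ?L \<epsilon>)"
        by (intro moderate_mult[OF g] moderate_power[OF g] c(1) L)
      show "net_hyperlim \<sigma> \<rho> ?Q (\<lambda>\<epsilon>. c \<epsilon> ^ (k - j) * ?L \<epsilon>)"
      proof (rule net_hyperlim_mult[OF g moderate_power[OF g c(1)] L])
        show "net_hyperlim \<sigma> \<rho> (\<lambda>n \<epsilon>. ((u n \<epsilon> - a \<epsilon>) / (v n \<epsilon> - b \<epsilon>)) ^ (k - j)) (\<lambda>\<epsilon>. c \<epsilon> ^ (k - j))"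
          by (rule net_hyperlim_power[OF g c(1) c_lim])
        show "net_hyperlim \<sigma> \<rho> (\<lambda>n \<epsilon>. w n \<epsilon> * inverse (z n \<epsilon>)) ?L"
          by (rule net_hyperlim_mult[OF g Fk bounded_away_inverse[OF g Gk_away] w(1)
                net_hyperlim_inverse[OF g Gk_away z(1)]])
      qed
      show "\<forall>\<^sub>F n in hypernat_top \<sigma>.
          gdiv \<rho> (gs_deriv \<rho> U f j (x n)) (gs_deriv \<rho> U g j (y n)) = gclass \<rho> (?Q n)"
        using mem z_away net_hyperlim_moderate[OF g Fk w(1)] net_hyperlim_moderate[OF g Gk z(1)]
      proof eventually_elim
        case (elim n)
        have un: "moderate \<rho> (u n)" "x n = gclass \<rho> (u n)"
          and vn: "moderate \<rho> (v n)" "y n = gclass \<rho> (v n)"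
          using u[OF elim(1)] v[OF elim(1)] by simp_all
        have inU: "gclass \<rho> (u n) \<in> U" "gclass \<rho> (v n) \<in> U"
          using funcset_mem[OF assms(4) elim(1)] funcset_mem[OF assms(5) elim(1)]
          by (simp_all add: un(2) vn(2))
        have remainder: "moderate \<rho> (\<lambda>\<epsilon>. h \<epsilon> / fact (k - j) * (r \<epsilon> - s \<epsilon>) ^ (k - j))"
          if "moderate \<rho> h" "moderate \<rho> r" "moderate \<rho> s" for h r s
          unfolding divide_inverse
          by (intro moderate_mult[OF g] moderate_power[OF g] moderate_diff[OF g] moderate_const[OF g] that)
        have A: "moderate \<rho> (?A n)" by (rule remainder[OF elim(3) un(1) a(1)])
        have B: "moderate \<rho> (?B n)" by (rule remainder[OF elim(4) vn(1) b(1)])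
        have fA: "gs_deriv \<rho> U f j (x n) = gclass \<rho> (?A n)"
          unfolding un(2) by (rule w(2)[rule_format, OF un(1) inU(1)])
        have gB: "gs_deriv \<rho> U g j (y n) = gclass \<rho> (?B n)"
          unfolding vn(2) by (rule z(2)[rule_format, OF vn(1) inU(2)])
        \<comment> \<open>For \<open>j < k\<close> invertibility is assumed at every
          \<open>y n\<close>. For \<open>j = k\<close> the remainder is \<open>z n\<close> itself,
          which is bounded away from zero on a tail because its hyperlimit represents the invertible
          \<open>g^(k)(m)\<close>.\<close>
        have "gclass \<rho> (?B n) \<in> Units (gring \<rho>)"
        proof (cases "j = k")
          case True
          then show ?thesis using elim(2) gclass_Units_iff[OF g elim(4)] by simp
        next
          case False
          then show ?thesis using assms(14)[OF elim(1), of j] j unfolding gB by simp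
        qed
        then have "gdiv \<rho> (gclass \<rho> (?A n)) (gclass \<rho> (?B n)) = gclass \<rho> (\<lambda>\<epsilon>. ?A n \<epsilon> / ?B n \<epsilon>)"
          unfolding gclass_Units_iff[OF g B] by (rule gdiv_gclass[OF g A B])
        also have "(\<lambda>\<epsilon>. ?A n \<epsilon> / ?B n \<epsilon>) = ?Q n"
          by (rule ext, rule taylor_quotient)
        finally show ?case unfolding fA gB .
      qed
    qed
    then show ?thesis
      by (simp add: c gring_pow[OF g c(1)] gring_ops(2)[OF g moderate_power[OF g c(1)] L])
  qed
  have "C [^]\<^bsub>gring \<rho>\<^esub> (k - k) \<otimes>\<^bsub>gring \<rho>\<^esub> gclass \<rho> ?L = gclass \<rho> ?L"
  proof -
    interpret cring "gring \<rho>" by (rule gring_cring[OF g])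
    show ?thesis using L by (simp add: gclass_in_carrier_iff[OF g])
  qed
  then show ?thesis using main[of k] main by (intro exI[of _ "gclass \<rho> ?L"]) auto
qed

end
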